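(* Let $[\underline{H},\overline{H}]\subset(0,1)$ be a compact interval and let $\{H_j:j\in\mathbb{Z}_+\}$ be a sequence of Lipschitz functions $[0,1]\to[\underline{H},\overline{H}]$ for which there is a constant $C_0>0$ with $\nu_j\le C_0(1+j)$ for all $j\in\mathbb{Z}_+$. Assume that for all $t\in(0,1)$ $$H(t):=\liminf_{j\to+\infty}H_j(t)<\underline{H}+\tfrac12 .$$ Let $X$ be the Gaussian Haar-based multifractional process built from $\{H_j\}$ and from independent standard Gaussian random variables $\varepsilon_{j,k}$ (with continuous sample paths). Then there is a universal event $\Omega^*$ of probability $1$ (not depending on $t$) such that on $\Omega^*$, $$\alpha_X(t)=H(t)\quad\text{for all } t\in(0,1).$$
   Context: $\mathbb{Z}_+$ is the set of non-negative integers. $(y)_+^\beta:=y^\beta$ if $y\ge 0$ and $(y)_+^\beta:=0$ otherwise. For a Lipschitz function $H_j$ on $[0,1]$, $\nu_j:=\sup_{x\in[0,1]}|H_j(x)|+\sup_{0\le x'<x''\le 1}\frac{|H_j(x'')-H_j(x')|}{x''-x'}$. The Haar mother wavelet is $h:=\mathbb{1}_{[0,1/2)}-\mathbb{1}_{[1/2,1)}$, and $h_{j,k}(s):=2^{j/2}h(2^js-k)$ for $j\in\mathbb{Z}_+$, $k\in\{0,\dots,2^j-1\}$, $s\in\mathbb{R}$. Let $\{\varepsilon_{j,k}: j\in\mathbb{Z}_+,\ k\in\{0,\dots,2^j-1\}\}$ be independent $\mathcal{N}(0,1)$ random variables on a probability space $(\Omega,\mathcal{F},\mathbb{P})$. The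 Gaussian Haar-based multifractional process (GHBMP) is $$X(t):=\sum_{j=0}^{+\infty}\sum_{k=0}^{2^j-1}\left(\int_0^1 (t-s)_+^{H_j(k/2^j)-1/2}h_{j,k}(s)\,ds\right)\varepsilon_{j,k},\qquad t\in[0,1],$$ where for each $t$ the series converges in $L_2(\Omega)$; $X$ is taken with continuous sample paths (continuous modification). The pointwise Hölder exponent of $X$ at $t$ is the random variable $$\alpha_X(t):=\sup\left\{\alpha\in\mathbb{R}_+:\ \limsup_{h\to0}\frac{|X(t+h)-X(t)|}{|h|^\alpha}=0\right\}.$$ *)

theory Defs
  imports "HOL-Probability.Probability"
begin

text \<open>The truncated power \<open>(y)\<^sub>+\<^sup>\<beta>\<close>. Since \<open>0 powr \<beta> = 0\<close> in HOL for every \<open>\<beta>\<close>, the value at the single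
  point \<open>y = 0\<close> may differ from the usual convention when \<open>\<beta> \<le> 0\<close>; this does not affect the
  Lebesgue integrals below.\<close>

definition pos_powr :: "real \<Rightarrow> real \<Rightarrow> real" where
  "pos_powr y \<beta> = (if y \<ge> 0 then y powr \<beta> else 0)"

text \<open>For a function that is Lipschitz on \<open>[0,1]\<close> both suprema are taken over nonempty sets of
  reals that are bounded above, so they are genuine.\<close>

definition lip_norm :: "(real \<Rightarrow> real) \<Rightarrow> real" where
  "lip_norm f = (SUP x\<in>{0..1}. \<bar>f x\<bar>)
     + (SUP (x', x'')\<in>{(x', x''). 0 \<le> x' \<and> x' < x'' \<and> x'' \<le> 1}. \<bar>f x'' - f x'\<bar> / (x'' - x'))"

definition haar_mother :: "real \<Rightarrow> real" where
  "haar_mother s = indicator {0..<1/2} s - indicator {1/2..<1} s"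

definition haar :: "nat \<Rightarrow> nat \<Rightarrow> real \<Rightarrow> real" where
  "haar j k s = 2 powr (real j / 2) * haar_mother (2 ^ j * s - real k)"

definition ghbmp_coeff :: "(nat \<Rightarrow> real \<Rightarrow> real) \<Rightarrow> nat \<Rightarrow> nat \<Rightarrow> real \<Rightarrow> real" where
  "ghbmp_coeff H j k t =
     (LBINT s:{0..1}. pos_powr (t - s) (H j (real k / 2 ^ j) - 1/2) * haar j k s)"

definition ghbmp_partial_sum ::
  "(nat \<Rightarrow> real \<Rightarrow> real) \<Rightarrow> (nat \<Rightarrow> nat \<Rightarrow> 'a \<Rightarrow> real) \<Rightarrow> nat \<Rightarrow> real \<Rightarrow> 'a \<Rightarrow> real" where
  "ghbmp_partial_sum H \<epsilon> J t \<omega> = (\<Sum>j<J. \<Sum>k<2 ^ j. ghbmp_coeff H j k t * \<epsilon> j k \<omega>)"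

definition std_gaussian_family :: "'a measure \<Rightarrow> (nat \<Rightarrow> nat \<Rightarrow> 'a \<Rightarrow> real) \<Rightarrow> bool" where
  "std_gaussian_family M \<epsilon> \<longleftrightarrow>
     prob_space.indep_vars M (\<lambda>_. borel) (\<lambda>(j, k). \<epsilon> j k) {(j, k). k < 2 ^ j} \<and>
     (\<forall>j. \<forall>k<2 ^ j. distributed M lborel (\<epsilon> j k) std_normal_density)"

text \<open>The \<open>L\<^sub>2\<close>-sum of the series determines each \<open>X t\<close> only almost surely. A process satisfies the
  predicate iff it is a version of that sum all of whose sample paths are continuous on \<open>[0,1]\<close>.
  The squared \<open>L\<^sub>2\<close>-distance is a nonnegative integral with values in \<open>[0,\<infinity>]\<close>, so that
  convergence to \<open>0\<close> is not trivialised by non-integrable functions.\<close>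

definition is_GHBMP ::
  "'a measure \<Rightarrow> (nat \<Rightarrow> real \<Rightarrow> real) \<Rightarrow> (nat \<Rightarrow> nat \<Rightarrow> 'a \<Rightarrow> real) \<Rightarrow> (real \<Rightarrow> 'a \<Rightarrow> real) \<Rightarrow> bool" where
  "is_GHBMP M H \<epsilon> X \<longleftrightarrow>
     (\<forall>t\<in>{0..1}. X t \<in> borel_measurable M) \<and>
     (\<forall>t\<in>{0..1}. (\<lambda>J. \<integral>\<^sup>+\<omega>. ennreal ((X t \<omega> - ghbmp_partial_sum H \<epsilon> J t \<omega>)\<^sup>2) \<partial>M) \<longlonglongrightarrow> 0) \<and>
     (\<forall>\<omega>\<in>space M. continuous_on {0..1} (\<lambda>t. X t \<omega>))"

text \<open>Extended-real valued, because the supremum is infinite e.g. for locally constant functions.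
  The increments are restricted to the domain \<open>[0,1]\<close> of the function.\<close>

definition pointwise_holder_exponent :: "(real \<Rightarrow> real) \<Rightarrow> real \<Rightarrow> ereal" where
  "pointwise_holder_exponent f t =
     Sup (ereal ` {\<alpha>. \<alpha> \<ge> 0 \<and>
       Limsup (at 0 within {h. t + h \<in> {0..1}}) (\<lambda>h. ereal (\<bar>f (t + h) - f t\<bar> / \<bar>h\<bar> powr \<alpha>)) = 0})"

end

theory Submission
  imports Defs "HOL-Real_Asymp.Real_Asymp"
begin

text \<open>
  With \<open>a = H\<^sub>j(k/2\<^sup>j)\<close> and \<open>b = a + 1/2\<close>, scaling turns the coefficient of \<open>\<epsilon>\<^bsub>j,k\<^esub>\<close> into
  \<open>2\<^bsup>-ja\<^esup> \<psi>\<^sub>b(2\<^sup>j t - k)\<close>, where \<open>\<psi>\<^sub>b\<close> is a second difference of \<open>x\<^sub>+\<^sup>b / b\<close>. Its increments over a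
  distance \<open>d\<close> are of size \<open>d\<^sup>\<theta> (1 + |x|)\<^bsup>b-2-\<theta>\<^esup>\<close> for every \<open>\<theta> \<le> min 1 b\<close>, which is summable over the
  translates \<open>k\<close> once \<open>\<theta> > a - 1/2\<close>. Since \<open>|\<epsilon>\<^bsub>j,k\<^esub>| \<le> K (1 + j)\<close> almost surely, the series and its increments
  can therefore be estimated path by path. Near \<open>t\<close> the exponents \<open>a\<close> are at least any \<open>\<beta> < H(t)\<close>, while the
  remote translates contribute negligibly; taking \<open>\<theta> = \<alpha> < \<beta>\<close> (allowed because \<open>H(t)\<close> is less than
  \<open>1/2\<close> plus the lower bound of the Hurst functions) yields \<open>|X(s) - X(t)| \<le> C |s - t|\<^sup>\<alpha>\<close>.

  Conversely, the kernel is causal, so the half-cell increments \<open>X((k + 1/2)/2\<^sup>J) - X(k/2\<^sup>J)\<close> depend on the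
  variables \<open>\<epsilon>\<^bsub>J,k'\<^esub>\<close> in a triangular way, with diagonal entries of size \<open>2\<^bsup>-Ja\<^esup>\<close>. Conditioning on one variable
  after the other, all increments of a block of \<open>J\<close> consecutive \<open>k\<close> are simultaneously smaller than
  \<open>2\<^bsup>-Ja\<^esup>/64\<close> with probability at most \<open>8\<^bsup>-J\<^esup>\<close>. By Borel-Cantelli, for all large \<open>J\<close> every such block contains a large
  increment. Blocks close to \<open>t\<close> at the levels where \<open>H\<^sub>J(t)\<close> is nearly \<open>H(t)\<close> rule out any Hoelder exponent
  above \<open>H(t)\<close>.
\<close>

section \<open>The response of the kernel to the Haar wavelet\<close>

text \<open>The integral of \<open>(x - s)\<^sub>+\<^bsup>b-1\<^esup>\<close> against the mother wavelet.\<close>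

definition haar_response :: "real \<Rightarrow> real \<Rightarrow> real" where
  "haar_response b x =
     (max 0 x powr b - 2 * max 0 (x - 1/2) powr b + max 0 (x - 1) powr b) / b"

lemma pos_powr_measurable [measurable]: "(\<lambda>x. pos_powr x c) \<in> borel_measurable borel"
  unfolding pos_powr_def by measurable

text \<open>Since the integrand is nonnegative, its nonnegative integral yields integrability and
  value at once, also for b < 1, where it is singular at 0.\<close>

lemma has_bochner_integral_pos_powr_atMost:
  fixes b x :: real
  assumes "0 < b"
  shows "has_bochner_integral lborel (\<lambda>y. pos_powr y (b - 1) * indicator {..x} y) (max 0 x powr b / b)"
proof (rule has_bochner_integral_nn_integral)
  show "(\<integral>\<^sup>+y. ennreal (pos_powr y (b - 1) * indicator {..x} y) \<partial>lborel) = ennreal (max 0 x powr b / b)"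
  proof (cases "x \<le> 0")
    case True
    then have "pos_powr y (b - 1) * indicator {..x} y = 0" for y
      by (auto simp: pos_powr_def indicator_def)
    with True show ?thesis by (simp only:) simp
  next
    case False
    have "((\<lambda>y. y powr (b - 1)) has_integral (x powr (b - 1 + 1) / (b - 1 + 1))) {0..x}"
      using assms False by (intro has_integral_powr_from_0) auto
    from nn_integral_has_integral_lebesgue'[OF _ this]
    have "(\<integral>\<^sup>+y. ennreal (y powr (b - 1)) * indicator {0..x} y \<partial>lborel) = ennreal (x powr b / b)"
      by simp
    moreover have "ennreal (pos_powr y (b - 1) * indicator {..x} y)
        = ennreal (y powr (b - 1)) * indicator {0..x} y" for y
      by (auto simp: pos_powr_def indicator_def)
    ultimately show ?thesis using False by (simp add: max_def)
  qed
qed (use assms in \<open>auto simp: pos_powr_def\<close>)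

text \<open>The reflection \<open>y = t - s\<close> of the preceding integral.\<close>

lemma has_bochner_integral_pos_powr_tail:
  fixes b t u :: real
  assumes "0 < b"
  shows "has_bochner_integral lborel (\<lambda>s. pos_powr (t - s) (b - 1) * indicator {u..} s)
           (max 0 (t - u) powr b / b)"
proof -
  have "has_bochner_integral lborel
      (\<lambda>s. pos_powr (t + - 1 * s) (b - 1) * indicator {..t - u} (t + - 1 * s)) (max 0 (t - u) powr b / b)"
    using has_bochner_integral_pos_powr_atMost[OF assms, of "t - u"]
    by (subst (asm) lborel_has_bochner_integral_real_affine_iff[where c = "-1" and t = t]) auto
  moreover have "pos_powr (t + - 1 * s) (b - 1) * indicator {..t - u} (t + - 1 * s)
      = pos_powr (t - s) (b - 1) * indicator {u..} s" for s
    by (auto simp: indicator_def)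
  ultimately show ?thesis by (simp only:)
qed

text \<open>Half-line indicators turn the integral against the wavelet into three tail integrals
  with a common closed form.\<close>

lemma haar_eq_indicators:
  "haar j k s = 2 powr (real j / 2) * (indicator {real k / 2 ^ j..} s
     - 2 * indicator {(real k + 1/2) / 2 ^ j..} s + indicator {(real k + 1) / 2 ^ j..} s)"
proof -
  have "haar_mother y = indicator {0..} y - 2 * indicator {1/2..} y + indicator {1..} y" for y
    by (auto simp: haar_mother_def indicator_def)
  moreover have "c / 2 ^ j \<le> s \<longleftrightarrow> c \<le> 2 ^ j * s" for c :: real
    by (simp add: field_simps)
  ultimately show ?thesis
    by (simp add: haar_def indicator_def le_diff_eq add.commute del: of_nat_add)
qed

lemma ghbmp_coeff_eq:
  assumes "k < 2 ^ j" and "0 < H j (real k / 2 ^ j)"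
  shows "ghbmp_coeff H j k t =
    2 powr (- real j * H j (real k / 2 ^ j)) * haar_response (H j (real k / 2 ^ j) + 1/2) (2 ^ j * t - real k)"
proof -
  define a where "a = H j (real k / 2 ^ j)"
  define b where "b = a + 1/2"
  have b: "0 < b" using assms by (simp add: b_def a_def)
  let ?g = "\<lambda>u s. pos_powr (t - s) (b - 1) * indicator {u..} s"
  have I: "has_bochner_integral lborel
     (\<lambda>s. 2 powr (real j / 2) * (?g (real k / 2 ^ j) s - 2 * ?g ((real k + 1/2) / 2 ^ j) s + ?g ((real k + 1) / 2 ^ j) s))
     (2 powr (real j / 2) * (max 0 (t - real k / 2 ^ j) powr b / b
        - 2 * (max 0 (t - (real k + 1/2) / 2 ^ j) powr b / b) + max 0 (t - (real k + 1) / 2 ^ j) powr b / b))"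
    by (intro has_bochner_integral_mult_right has_bochner_integral_add has_bochner_integral_diff
        has_bochner_integral_pos_powr_tail b)
  \<comment> \<open>The wavelet is supported in one dyadic cell of [0,1], so the integral over [0,1]
    equals the integral over the line.\<close>
  have supp: "haar j k s = 0" if "s \<notin> {0..1}" for s
  proof -
    have "real k + 1 \<le> 2 ^ j" using assms(1)
      by (metis Suc_leI of_nat_Suc of_nat_le_iff of_nat_numeral of_nat_power add.commute)
    then have "2 ^ j * s - real k \<notin> {0..<1}"
      using that by (cases "s < 0") (auto simp: not_le mult_less_0_iff mult_neg_pos mult_pos_neg
        dest: mult_strict_left_mono[of 1 s "2 ^ j"] mult_strict_left_mono[of s 0 "2 ^ j"])
    then show ?thesis by (auto simp: haar_def haar_mother_def indicator_def)
  qed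
  have "ghbmp_coeff H j k t = (LBINT s. pos_powr (t - s) (b - 1) * haar j k s)"
    unfolding ghbmp_coeff_def set_lebesgue_integral_def
  proof (rule Bochner_Integration.integral_cong)
    show "indicator {0..1} s *\<^sub>R (pos_powr (t - s) (H j (real k / 2 ^ j) - 1/2) * haar j k s)
        = pos_powr (t - s) (b - 1) * haar j k s" for s
      using supp[of s] by (cases "s \<in> {0..1}") (simp_all add: b_def a_def)
  qed simp
  also have "\<dots> = (LBINT s. 2 powr (real j / 2) * (?g (real k / 2 ^ j) s
       - 2 * ?g ((real k + 1/2) / 2 ^ j) s + ?g ((real k + 1) / 2 ^ j) s))"
    by (rule Bochner_Integration.integral_cong) (auto simp: haar_eq_indicators algebra_simps)
  also have "\<dots> = 2 powr (real j / 2) * (max 0 (t - real k / 2 ^ j) powr b / b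
        - 2 * (max 0 (t - (real k + 1/2) / 2 ^ j) powr b / b) + max 0 (t - (real k + 1) / 2 ^ j) powr b / b)"
    using I by (rule has_bochner_integral_integral_eq)
  \<comment> \<open>Homogeneity extracts \<open>2 powr (- real j * b)\<close>; together with the
    normalisation \<open>2 powr (real j / 2)\<close> this leaves
    \<open>2 powr (- real j * a)\<close>.\<close>
  also have "max 0 (t - c / 2 ^ j) powr b = 2 powr (- real j * b) * max 0 (2 ^ j * t - c) powr b" for c
  proof -
    have "max 0 (t - c / 2 ^ j) = max 0 (2 ^ j * t - c) / 2 ^ j"
      by (auto simp: max_def field_simps)
    then have "max 0 (t - c / 2 ^ j) powr b = (max 0 (2 ^ j * t - c) / 2 powr real j) powr b"
      by (simp add: powr_realpow)
    also have "\<dots> = 2 powr (- real j * b) * max 0 (2 ^ j * t - c) powr b"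
      by (subst powr_divide) (simp_all add: powr_powr powr_minus_divide)
    finally show ?thesis .
  qed
  note this[of "real k"] this[of "real k + 1/2"] this[of "real k + 1"]
  ultimately have "ghbmp_coeff H j k t = 2 powr (real j / 2) * 2 powr (- real j * b) * haar_response b (2 ^ j * t - real k)"
    using b by (simp add: haar_response_def algebra_simps add_divide_distrib diff_divide_distrib)
  moreover have "2 powr (real j / 2) * 2 powr (- real j * b) = (2::real) powr (- real j * a)"
    by (simp add: powr_add[symmetric] b_def algebra_simps)
  ultimately show ?thesis by (simp add: b_def a_def)
qed

section \<open>Increments of the response\<close>

text \<open>The mean value theorem is used twice, each time over a step of length 1/2, whence the
  factor 1/4; \<open>1 < x\<close> keeps all intermediate points positive.\<close>

lemma second_difference_powr:
  fixes p x :: real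
  assumes "1 < x"
  obtains \<xi> where "x - 1 < \<xi>" "\<xi> < x"
    "x powr p - 2 * (x - 1/2) powr p + (x - 1) powr p = p * (p - 1) / 4 * \<xi> powr (p - 2)"
proof -
  let ?\<phi> = "\<lambda>u. (u + 1/2) powr p - u powr p"
  let ?\<phi>' = "\<lambda>u. p * (u + 1/2) powr (p - 1) - p * u powr (p - 1)"
  have "\<exists>z>x - 1. z < x - 1/2 \<and> ?\<phi> (x - 1/2) - ?\<phi> (x - 1) = (x - 1/2 - (x - 1)) * ?\<phi>' z"
    by (rule MVT2) (use assms in \<open>auto intro!: derivative_eq_intros\<close>)
  then obtain z where z: "x - 1 < z" "z < x - 1/2" "?\<phi> (x - 1/2) - ?\<phi> (x - 1) = 1/2 * ?\<phi>' z"
    by auto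
  have "\<exists>\<xi>>z. \<xi> < z + 1/2 \<and> (z + 1/2) powr (p - 1) - z powr (p - 1)
      = (z + 1/2 - z) * ((p - 1) * \<xi> powr (p - 1 - 1))"
    by (rule MVT2) (use assms z in \<open>auto intro!: derivative_eq_intros\<close>)
  then obtain \<xi> where \<xi>: "z < \<xi>" "\<xi> < z + 1/2"
    "(z + 1/2) powr (p - 1) - z powr (p - 1) = 1/2 * ((p - 1) * \<xi> powr (p - 2))"
    by auto
  have "?\<phi>' z = p * (1/2 * ((p - 1) * \<xi> powr (p - 2)))"
    using \<xi>(3) by (metis right_diff_distrib)
  then have "x powr p - 2 * (x - 1/2) powr p + (x - 1) powr p = p * (p - 1) / 4 * \<xi> powr (p - 2)"
    using z(3) by (simp add: algebra_simps)
  with z \<xi> show ?thesis by (intro that[of \<xi>]) auto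
qed

text \<open>For x \<ge> 2 one has x - 1 \<ge> (1 + x)/3, and the base 1/3 costs at most 3^3 =
  27.\<close>

lemma powr_one_third_bound:
  fixes x c :: real
  assumes "2 \<le> x" "x - 1 \<le> \<xi>" "- 3 \<le> c" "c \<le> 0"
  shows "\<xi> powr c \<le> 27 * (1 + x) powr c"
proof -
  have "\<xi> powr c \<le> ((1 + x) / 3) powr c"
    using assms by (intro powr_mono2') auto
  also have "\<dots> = (1 + x) powr c * 3 powr (- c)"
    using assms by (subst powr_divide) (auto simp: powr_minus field_simps)
  also have "\<dots> \<le> (1 + x) powr c * 3 powr 3"
    using assms by (intro mult_left_mono powr_mono) auto
  finally show ?thesis by simp
qed

lemma haar_response_nonpos: "x \<le> 0 \<Longrightarrow> haar_response b x = 0"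
  by (simp add: haar_response_def)

lemma haar_response_far:
  assumes "1 < x" "0 < b"
  shows "haar_response b x = (x powr b - 2 * (x - 1/2) powr b + (x - 1) powr b) / b"
  using assms by (simp add: haar_response_def max_def)

text \<open>Up to x = 2 the three powers are bounded outright; beyond that the cancellation in the
  second difference lowers the exponent b by 2.\<close>

lemma abs_haar_response_le:
  assumes "1/2 \<le> b" "b \<le> 3/2"
  shows "\<bar>haar_response b x\<bar> \<le> 300 * (1 + \<bar>x\<bar>) powr (b - 2)"
proof -
  consider "x \<le> 0" | "0 < x" "x \<le> 2" | "2 < x" by linarith
  then show ?thesis
  proof cases
    case 1
    then show ?thesis by (simp add: haar_response_nonpos)
  next
    case 2
    have p: "0 \<le> max 0 (x - c) powr b \<and> max 0 (x - c) powr b \<le> 4" if "0 \<le> c" for c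
    proof -
      have "max 0 (x - c) powr b \<le> 2 powr b"
        using 2 that assms by (intro powr_mono2) auto
      also have "\<dots> \<le> 2 powr 2" using assms by (intro powr_mono) auto
      finally show ?thesis by simp
    qed
    have "\<bar>max 0 x powr b - 2 * max 0 (x - 1/2) powr b + max 0 (x - 1) powr b\<bar> \<le> 8"
    proof -
      have "0 \<le> max 0 x powr b \<and> max 0 x powr b \<le> 4" using p[of 0] by simp
      with p[of "1/2"] p[of 1] show ?thesis by linarith
    qed
    then have "\<bar>haar_response b x\<bar> \<le> 8 / b"
      using assms by (simp add: haar_response_def abs_divide divide_right_mono)
    also have "\<dots> \<le> 16" using assms by (simp add: field_simps)
    \<comment> \<open>Here 1 + |x| \<le> 3 and b - 2 \<ge> -2, so the weight is at least 1/9, and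
      300/9 exceeds 16.\<close>
    also have "\<dots> \<le> 300 * 3 powr (-2)" by (simp add: powr_minus)
    also have "\<dots> \<le> 300 * 3 powr (b - 2)" using assms by (intro mult_left_mono powr_mono) auto
    also have "\<dots> \<le> 300 * (1 + \<bar>x\<bar>) powr (b - 2)"
      using 2 assms by (intro mult_left_mono powr_mono2') auto
    finally show ?thesis .
  next
    case 3
    obtain \<xi> where \<xi>: "x - 1 < \<xi>"
      "x powr b - 2 * (x - 1/2) powr b + (x - 1) powr b = b * (b - 1) / 4 * \<xi> powr (b - 2)"
      using second_difference_powr[of x b] 3 by auto
    have "\<bar>haar_response b x\<bar> = \<bar>b - 1\<bar> / 4 * \<xi> powr (b - 2)"
    proof -
      have "haar_response b x = (b - 1) / 4 * \<xi> powr (b - 2)"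
        using 3 assms by (subst haar_response_far) (simp_all only: \<xi>(2), simp_all)
      then have "\<bar>haar_response b x\<bar> = \<bar>(b - 1) / 4 * \<xi> powr (b - 2)\<bar>" by (simp only:)
      then show ?thesis by (simp add: abs_mult)
    qed
    also have "\<dots> \<le> 1 * (27 * (1 + x) powr (b - 2))"
      using 3 assms \<xi>(1) by (intro mult_mono powr_one_third_bound) auto
    finally show ?thesis using 3 by simp
  qed
qed

text \<open>Differentiation cancels the factor 1/b and leaves the second difference of the power b -
  1, which decays with exponent b - 3.\<close>

lemma haar_response_mean_value_bound:
  assumes "1/2 \<le> b" "b \<le> 3/2" "2 < x" "x < z"
  shows "\<bar>haar_response b z - haar_response b x\<bar> \<le> 27 * (z - x) * (1 + x) powr (b - 3)"
proof -
  let ?f = "\<lambda>x. (x powr b - 2 * (x - 1/2) powr b + (x - 1) powr b) / b"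
  let ?f' = "\<lambda>x. x powr (b - 1) - 2 * (x - 1/2) powr (b - 1) + (x - 1) powr (b - 1)"
  have "\<exists>w>x. w < z \<and> ?f z - ?f x = (z - x) * ?f' w"
  proof (rule MVT2)
    fix w assume w: "x \<le> w" "w \<le> z"
    have "(?f has_real_derivative
        (b * w powr (b - 1) - 2 * (b * (w - 1/2) powr (b - 1)) + b * (w - 1) powr (b - 1)) / b) (at w)"
      using assms w by (auto intro!: derivative_eq_intros)
    also have "(b * w powr (b - 1) - 2 * (b * (w - 1/2) powr (b - 1)) + b * (w - 1) powr (b - 1)) / b = ?f' w"
      using assms by (simp add: field_simps)
    finally show "(?f has_real_derivative ?f' w) (at w)" .
  qed (use assms in auto)
  then obtain w where w: "x < w" "w < z" "?f z - ?f x = (z - x) * ?f' w" by blast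
  obtain \<xi> where \<xi>: "w - 1 < \<xi>" "?f' w = (b - 1) * (b - 1 - 1) / 4 * \<xi> powr (b - 1 - 2)"
    using second_difference_powr[of w "b - 1"] w assms by auto
  have c: "\<bar>(b - 1) * (b - 1 - 1)\<bar> \<le> 1 * 4"
    unfolding abs_mult using assms by (intro mult_mono) auto
  have "\<bar>?f' w\<bar> = \<bar>(b - 1) * (b - 1 - 1)\<bar> / 4 * \<xi> powr (b - 3)"
    unfolding \<xi>(2) by (simp add: abs_mult)
  also have "\<dots> \<le> 1 * (27 * (1 + x) powr (b - 3))"
    using c assms w \<xi>(1) by (intro mult_mono powr_one_third_bound) auto
  finally have "(z - x) * \<bar>?f' w\<bar> \<le> (z - x) * (27 * (1 + x) powr (b - 3))"
    using assms by (intro mult_left_mono) auto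
  moreover have "\<bar>haar_response b z - haar_response b x\<bar> = (z - x) * \<bar>?f' w\<bar>"
    using assms w by (simp add: haar_response_far abs_mult)
  ultimately show ?thesis by (simp only: mult.assoc mult.left_commute)
qed

text \<open>A share \<open>w / (u + v)\<close> lies in [0,1] and so is at most its own b-th power;
  the shares of u and v add up to 1.\<close>

lemma powr_add_le_powr_add_powr:
  fixes u v b :: real
  assumes "0 \<le> u" "0 \<le> v" "0 \<le> b" "b \<le> 1"
  shows "(u + v) powr b \<le> u powr b + v powr b"
proof (cases "u + v = 0")
  case True
  then show ?thesis by simp
next
  case False
  with assms have s: "u + v > 0" by simp
  have *: "w / (u + v) * (u + v) powr b \<le> w powr b" if "0 \<le> w" "w \<le> u + v" for w
  proof -
    have "w / (u + v) = (w / (u + v)) powr 1" using that s by simp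
    also have "\<dots> \<le> (w / (u + v)) powr b"
      using that s assms by (intro powr_mono') auto
    also have "\<dots> = w powr b / (u + v) powr b" using that s by (simp add: powr_divide)
    finally show ?thesis using s by (simp add: field_simps)
  qed
  have "(u + v) powr b = u / (u + v) * (u + v) powr b + v / (u + v) * (u + v) powr b"
    using s by (simp add: distrib_right[symmetric] add_divide_distrib[symmetric])
  also have "\<dots> \<le> u powr b + v powr b" using assms by (intro add_mono *) auto
  finally show ?thesis .
qed

text \<open>For b \<le> 1 subadditivity applies, otherwise the mean value theorem with derivative at
  most 3/2 * 8 = 12. Lowering the exponent to \<theta> uses v - u \<le> 1.\<close>

lemma powr_diff_le_local:
  fixes u v b \<theta> :: real
  assumes "0 \<le> u" "u \<le> v" "v \<le> 8" "v - u \<le> 1" "1/2 \<le> b" "b \<le> 3/2" "0 \<le> \<theta>" "\<theta> \<le> min 1 b"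
  shows "v powr b - u powr b \<le> 12 * (v - u) powr \<theta>"
proof (cases "b \<le> 1")
  case True
  have "v powr b - u powr b \<le> (v - u) powr b"
    using powr_add_le_powr_add_powr[of u "v - u" b] assms True by simp
  also have "\<dots> \<le> (v - u) powr \<theta>" using assms by (intro powr_mono') auto
  finally show ?thesis using powr_ge_zero[of "v - u" \<theta>] by linarith
next
  case False
  have "v powr b - u powr b \<le> 12 * (v - u)"
  proof (cases "u = v")
    case F: False
    have cont: "continuous_on {u..v} (\<lambda>x. x powr b)"
      using assms by (intro continuous_on_powr' continuous_intros) auto
    have der: "((\<lambda>x. x powr b) has_derivative (\<lambda>h. h * (b * x powr (b - 1)))) (at x)" if "u < x" for x
    proof -
      have "((\<lambda>x. x powr b) has_real_derivative b * x powr (b - 1)) (at x)"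
        using that assms by (auto intro!: derivative_eq_intros)
      then show ?thesis by (simp only: has_field_derivative_def mult_commute_abs)
    qed
    have "u < v" using F assms by simp
    obtain z where z: "u < z" "z < v" "v powr b - u powr b = (v - u) * (b * z powr (b - 1))"
      by (rule mvt[OF \<open>u < v\<close> cont der])
    have "z powr (b - 1) \<le> 8 powr (b - 1)"
      using z assms False by (intro powr_mono2) auto
    also have "\<dots> \<le> 8 powr 1" using assms by (intro powr_mono) auto
    finally have "b * z powr (b - 1) \<le> 3/2 * 8" using assms by (intro mult_mono) auto
    then have "(v - u) * (b * z powr (b - 1)) \<le> (v - u) * 12" using assms by (intro mult_left_mono) auto
    then show ?thesis using z by simp
  qed simp
  also have "\<dots> \<le> 12 * (v - u) powr \<theta>"
    using powr_mono'[of \<theta> 1 "v - u"] assms by simp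
  finally show ?thesis .
qed

text \<open>Truncation is 1-Lipschitz, so each of the three powers varies by at most 12 times the
  power of z - x; the weights 1, 2, 1 and 1/b \<le> 2 give 96.\<close>

lemma haar_response_local:
  fixes x z b \<theta> :: real
  assumes "x \<le> z" "z \<le> 8" "z - x \<le> 1" "1/2 \<le> b" "b \<le> 3/2" "0 \<le> \<theta>" "\<theta> \<le> min 1 b"
  shows "\<bar>haar_response b z - haar_response b x\<bar> \<le> 96 * (z - x) powr \<theta>"
proof -
  have p: "0 \<le> max 0 (z - c) powr b - max 0 (x - c) powr b \<and>
      max 0 (z - c) powr b - max 0 (x - c) powr b \<le> 12 * (z - x) powr \<theta>" if "0 \<le> c" for c
  proof
    show "0 \<le> max 0 (z - c) powr b - max 0 (x - c) powr b"
      using assms by (simp add: powr_mono2)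
    have "max 0 (z - c) powr b - max 0 (x - c) powr b \<le> 12 * (max 0 (z - c) - max 0 (x - c)) powr \<theta>"
      using assms that by (intro powr_diff_le_local) auto
    also have "\<dots> \<le> 12 * (z - x) powr \<theta>"
      using assms by (intro mult_left_mono powr_mono2) auto
    finally show "max 0 (z - c) powr b - max 0 (x - c) powr b \<le> 12 * (z - x) powr \<theta>" .
  qed
  have "\<bar>(A - 2 * B + C) / b\<bar> \<le> 96 * D" if "0 \<le> A \<and> A \<le> 12 * D" "0 \<le> B \<and> B \<le> 12 * D" "0 \<le> C \<and> C \<le> 12 * D"
    for A B C D :: real
  proof -
    have "\<bar>(A - 2 * B + C) / b\<bar> = \<bar>A - 2 * B + C\<bar> / b" using assms by simp
    also have "\<dots> \<le> 48 * D / (1/2)" using assms that by (intro frac_le) auto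
    finally show ?thesis by simp
  qed
  note * = this[OF p[of 0, unfolded diff_0_right, OF order_refl]
      p[of "1/2", OF order.strict_implies_order[OF half_gt_zero[OF zero_less_one]]] p[of 1, OF zero_le_one]]
  have "A / b - A' / b = (B - B' - 2 * (C - C') + (D - D')) / b" if "A = B - 2 * C + D" "A' = B' - 2 * C' + D'"
    for A B C D A' B' C' D'
    using that by (simp add: diff_divide_distrib[symmetric])
  note ** = this[OF refl refl]
  show ?thesis
    unfolding haar_response_def ** by (rule *)
qed

text \<open>Interpolates between the size bound of order b - 2 and the derivative bound of order b -
  3. The weights of both end points make the claim symmetric, so x \<le> z may be assumed.\<close>

lemma haar_response_increment:
  assumes "1/2 \<le> b" "b \<le> 3/2" "0 \<le> \<theta>" "\<theta> \<le> min 1 b"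
  shows "\<bar>haar_response b z - haar_response b x\<bar>
    \<le> 100000 * \<bar>z - x\<bar> powr \<theta> * ((1 + \<bar>x\<bar>) powr (b - 2 - \<theta>) + (1 + \<bar>z\<bar>) powr (b - 2 - \<theta>))"
proof (induction x z rule: linorder_wlog)
  case (sym x z)
  then show ?case by (simp add: abs_minus_commute add.commute)
next
  case (le x z)
  define d where "d = z - x"
  define Y where "Y = (\<lambda>x::real. (1 + \<bar>x\<bar>) powr (b - 2 - \<theta>))"
  have Y0: "0 \<le> Y w" for w by (simp add: Y_def)
  consider "d = 0" | "d > 0" "1 + \<bar>x\<bar> \<le> 8 * d" | "d > 0" "8 * d < 1 + \<bar>x\<bar>" "\<bar>x\<bar> \<le> 7"
    | "d > 0" "8 * d < 1 + \<bar>x\<bar>" "x < -7" | "d > 0" "8 * d < 1 + \<bar>x\<bar>" "x > 7"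
    using le by (auto simp: d_def) (smt (verit))
  \<comment> \<open>Large \<open>d\<close>: both values are small. Small \<open>d\<close>: local Hoelder continuity near the
    singularities \<open>0, 1/2, 1\<close>, the mean value theorem far from them.\<close>
  then have "\<bar>haar_response b z - haar_response b x\<bar> \<le> 100000 * d powr \<theta> * (Y x + Y z)"
  proof cases
    case 1
    then show ?thesis using Y0 by (simp add: d_def)
  next
    case 2
    \<comment> \<open>The bound 9 d covers both points, as 1 + |z| \<le> 1 + |x| + d. It exchanges
      (1 + |w|) to the power \<theta> for at most 9 times that power of d, and 9 * 300 =
      2700.\<close>
    have *: "\<bar>haar_response b w\<bar> \<le> 2700 * d powr \<theta> * Y w" if "1 + \<bar>w\<bar> \<le> 9 * d" for w
    proof -
      have "(1 + \<bar>w\<bar>) powr (b - 2) = (1 + \<bar>w\<bar>) powr \<theta> * Y w"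
        by (simp add: Y_def powr_add[symmetric])
      also have "(1 + \<bar>w\<bar>) powr \<theta> \<le> (9 * d) powr \<theta>"
        using that assms by (intro powr_mono2) auto
      also have "\<dots> = 9 powr \<theta> * d powr \<theta>" using 2 by (simp add: powr_mult)
      also have "(9::real) powr \<theta> \<le> 9 powr 1" using assms by (intro powr_mono) auto
      finally have "(1 + \<bar>w\<bar>) powr (b - 2) \<le> 9 * d powr \<theta> * Y w"
        using Y0 by (simp add: mult_right_mono)
      then show ?thesis using abs_haar_response_le[of b w] assms by linarith
    qed
    have "\<bar>haar_response b x\<bar> \<le> 2700 * d powr \<theta> * Y x" "\<bar>haar_response b z\<bar> \<le> 2700 * d powr \<theta> * Y z"
      by (rule *; use 2 le in \<open>auto simp: d_def\<close>)+
    then have "\<bar>haar_response b z - haar_response b x\<bar> \<le> 2700 * (d powr \<theta> * (Y x + Y z))"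
      unfolding distrib_left by linarith
    also have "\<dots> \<le> 100000 * (d powr \<theta> * (Y x + Y z))"
      using Y0 by (intro mult_right_mono mult_nonneg_nonneg add_nonneg_nonneg) auto
    finally show ?thesis by (simp add: mult_ac)
  next
    case 3
    \<comment> \<open>The exponent is at least -3 and 1 + |x| \<le> 8, so the weight is at least
      1/512; 96 * 512 = 49152 dictates the size of the final constant.\<close>
    have "8 powr (-3) \<le> (8::real) powr (b - 2 - \<theta>)" using assms by (intro powr_mono) auto
    also have "\<dots> \<le> Y x" unfolding Y_def using 3 assms by (intro powr_mono2') auto
    finally have "1/512 \<le> Y x" by (simp add: powr_minus)
    have "\<bar>haar_response b z - haar_response b x\<bar> \<le> 96 * d powr \<theta>"
      unfolding d_def using 3 assms le by (intro haar_response_local) (auto simp: d_def)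
    also have "\<dots> = 49152 * d powr \<theta> * (1/512)" by simp
    also have "\<dots> \<le> 100000 * d powr \<theta> * (Y x + Y z)"
      using \<open>1/512 \<le> Y x\<close> Y0[of z] by (intro mult_mono) auto
    finally show ?thesis .
  next
    case 4
    \<comment> \<open>The gap d is less than (1 - x)/8, too short to reach the support of the
      response from x < -7.\<close>
    then have "z \<le> 0" "x \<le> 0" by (auto simp: d_def)
    then show ?thesis using Y0 by (simp add: haar_response_nonpos)
  next
    case 5
    have "\<bar>haar_response b z - haar_response b x\<bar> \<le> 27 * (z - x) * (1 + x) powr (b - 3)"
      using 5 assms by (intro haar_response_mean_value_bound) (auto simp: d_def)
    \<comment> \<open>Only the part d^\<theta> of the increment is kept; d < 1 + x converts the
      rest, and 1 - \<theta> + b - 3 = b - 2 - \<theta>.\<close>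
    also have "z - x = d powr \<theta> * d powr (1 - \<theta>)"
      using 5 by (simp add: d_def powr_add[symmetric])
    also have "27 * (d powr \<theta> * d powr (1 - \<theta>)) * (1 + x) powr (b - 3)
        \<le> 27 * (d powr \<theta> * (1 + x) powr (1 - \<theta>)) * (1 + x) powr (b - 3)"
      using 5 assms by (intro mult_right_mono mult_left_mono powr_mono2) auto
    also have "\<dots> = 27 * d powr \<theta> * Y x"
      using 5 by (simp add: Y_def powr_add[symmetric] algebra_simps)
    also have "\<dots> \<le> 100000 * d powr \<theta> * (Y x + Y z)"
      using Y0 by (intro mult_mono) auto
    finally show ?thesis .
  qed
  then show ?case using le by (simp add: d_def Y_def)
qed

section \<open>Increments of the coefficients\<close>

text \<open>Each distance n from k to the floor of x occurs at most once on either side, and 1 + |x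
  - k| \<ge> (1 + n)/2. Twice a convergent series is thus a bound uniform in x and N.\<close>

lemma sum_powr_decay_bounded:
  fixes \<iota> :: real
  assumes "0 < \<iota>"
  obtains Z where "0 \<le> Z" "\<And>x N. (\<Sum>k<N. (1 + \<bar>x - real k\<bar>) powr (- 1 - \<iota>)) \<le> Z"
proof -
  define g where "g n = 2 powr (1 + \<iota>) * real (Suc n) powr (- 1 - \<iota>)" for n
  have "summable (\<lambda>n. real n powr (- 1 - \<iota>))" using assms by (simp add: summable_real_powr_iff)
  then have "summable (\<lambda>n. real (Suc n) powr (- 1 - \<iota>))" by (subst summable_Suc_iff)
  then have g: "summable g" unfolding g_def by (rule summable_mult)
  have g0: "0 \<le> g n" for n by (simp add: g_def)
  show ?thesis
  proof (rule that[of "2 * suminf g"])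
    show "0 \<le> 2 * suminf g" using suminf_nonneg[OF g] g0 by simp
    fix x :: real and N
    let ?n = "\<lambda>k. nat \<bar>\<lfloor>x\<rfloor> - int k\<bar>"
    have decay: "(1 + \<bar>x - real k\<bar>) powr (- 1 - \<iota>) \<le> g (?n k)" for k
    proof -
      have "real (Suc (?n k)) / 2 \<le> 1 + \<bar>x - real k\<bar>"
      proof -
        have "(1 + \<bar>m - r\<bar>) / 2 \<le> 1 + \<bar>x - r\<bar>" if "m \<le> x" "x < m + 1" for m r :: real
          using that by (simp add: abs_if)
        from this[OF of_int_floor_le real_of_int_floor_add_one_gt, of "real k"] show ?thesis by simp
      qed
      then have "(1 + \<bar>x - real k\<bar>) powr (- 1 - \<iota>) \<le> (real (Suc (?n k)) / 2) powr (- 1 - \<iota>)"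
        using assms by (intro powr_mono2') auto
      also have "\<dots> = real (Suc (?n k)) powr (- 1 - \<iota>) / 2 powr (- 1 - \<iota>)"
        by (subst powr_divide) auto
      also have "\<dots> = g (?n k)"
        using powr_minus_divide[of 2 "1 + \<iota>"] by (simp add: g_def)
      finally show ?thesis .
    qed
    have part: "(\<Sum>k\<in>A. g (?n k)) \<le> suminf g" if "inj_on ?n A" "finite A" for A
    proof -
      have "(\<Sum>k\<in>A. g (?n k)) = sum g (?n ` A)" using that by (simp add: sum.reindex)
      also have "\<dots> \<le> suminf g" using that g g0 by (intro sum_le_suminf) auto
      finally show ?thesis .
    qed
    have "(\<Sum>k<N. (1 + \<bar>x - real k\<bar>) powr (- 1 - \<iota>)) \<le> (\<Sum>k<N. g (?n k))"
      by (intro sum_mono decay)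
    also have "\<dots> = (\<Sum>k\<in>{k\<in>{..<N}. int k \<le> \<lfloor>x\<rfloor>} \<union> {k\<in>{..<N}. \<not> int k \<le> \<lfloor>x\<rfloor>}. g (?n k))"
      by (rule sum.cong) auto
    also have "\<dots> = (\<Sum>k\<in>{k\<in>{..<N}. int k \<le> \<lfloor>x\<rfloor>}. g (?n k))
        + (\<Sum>k\<in>{k\<in>{..<N}. \<not> int k \<le> \<lfloor>x\<rfloor>}. g (?n k))"
      by (rule sum.union_disjoint) auto
    also have "\<dots> \<le> suminf g + suminf g"
      by (intro add_mono part) (auto simp: inj_on_def)
    finally show "(\<Sum>k<N. (1 + \<bar>x - real k\<bar>) powr (- 1 - \<iota>)) \<le> 2 * suminf g" by simp
  qed
qed

text \<open>Lowers the exponent although the base may exceed 1: a base up to 2 and exponents at most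
  1 apart cost a factor 2.\<close>

lemma powr_le_two_powr:
  fixes w a \<beta> :: real
  assumes "0 < w" "w \<le> 2" "\<beta> \<le> a" "a \<le> \<beta> + 1"
  shows "w powr a \<le> 2 * w powr \<beta>"
proof -
  have "w powr (a - \<beta>) \<le> 2 powr (a - \<beta>)" using assms by (intro powr_mono2) auto
  also have "\<dots> \<le> 2 powr 1" using assms by (intro powr_mono) auto
  finally have "w powr (a - \<beta>) * w powr \<beta> \<le> 2 * w powr \<beta>" by (simp add: mult_right_mono)
  then show ?thesis using assms by (simp add: powr_add[symmetric])
qed

section \<open>Sums of coefficient increments over one dyadic level\<close>

locale hurst_sequence =
  fixes Hlow Hup C0 :: real and H :: "nat \<Rightarrow> real \<Rightarrow> real"
  assumes Hlow_pos: "0 < Hlow" and Hup_less: "Hup < 1"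
    and H_range: "\<And>j x. 0 \<le> x \<Longrightarrow> x \<le> 1 \<Longrightarrow> Hlow \<le> H j x \<and> H j x \<le> Hup"
    and H_lipschitz: "\<And>j x y. 0 \<le> x \<Longrightarrow> x \<le> 1 \<Longrightarrow> 0 \<le> y \<Longrightarrow> y \<le> 1 \<Longrightarrow>
      \<bar>H j x - H j y\<bar> \<le> C0 * (1 + real j) * \<bar>x - y\<bar>"
begin

lemma dyadic_unit: "k < 2 ^ j \<Longrightarrow> 0 \<le> real k / 2 ^ j \<and> real k / 2 ^ j \<le> 1"
  by (simp add: divide_le_eq_1)

lemma H_dyadic: "k < 2 ^ j \<Longrightarrow> Hlow \<le> H j (real k / 2 ^ j) \<and> H j (real k / 2 ^ j) \<le> Hup"
  using dyadic_unit[of k j] H_range[of "real k / 2 ^ j" j] by blast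

lemma coeff_eq:
  assumes "k < 2 ^ j"
  shows "ghbmp_coeff H j k t =
    2 powr (- real j * H j (real k / 2 ^ j)) * haar_response (H j (real k / 2 ^ j) + 1/2) (2 ^ j * t - real k)"
  using H_dyadic[OF assms] Hlow_pos by (intro ghbmp_coeff_eq assms) auto

text \<open>With \<open>y = 1 + |2\<^sup>j x - k|\<close> the weight of a coefficient is \<open>(y / 2\<^sup>j)\<^sup>a\<close>. In the bound \<open>A y\<^sup>\<beta>\<close> for it the
  factor \<open>A\<close> carries the decay in \<open>j\<close>, and the power \<open>y\<^sup>\<beta>\<close> is absorbed by the spatial decay of the response.\<close>

definition increment_constant :: "real \<Rightarrow> real \<Rightarrow> bool" where
  "increment_constant \<iota> C \<longleftrightarrow> 0 \<le> C \<and> (\<forall>A \<beta> \<theta> j s t.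
     0 \<le> A \<and> 0 \<le> \<theta> \<and> \<theta> \<le> min 1 (Hlow + 1/2) \<and> \<beta> - 3/2 - \<theta> \<le> - 1 - \<iota> \<and>
     (\<forall>k<2 ^ j. \<forall>x\<in>{s, t}. ((1 + \<bar>2 ^ j * x - real k\<bar>) / 2 ^ j) powr H j (real k / 2 ^ j)
        \<le> A * (1 + \<bar>2 ^ j * x - real k\<bar>) powr \<beta>) \<longrightarrow>
     (\<Sum>k<2 ^ j. \<bar>ghbmp_coeff H j k s - ghbmp_coeff H j k t\<bar>) \<le> C * A * (2 ^ j * \<bar>s - t\<bar>) powr \<theta>)"

lemma increment_constantD:
  assumes "increment_constant \<iota> C" "0 \<le> A" "0 \<le> \<theta>" "\<theta> \<le> min 1 (Hlow + 1/2)" "\<beta> - 3/2 - \<theta> \<le> - 1 - \<iota>"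
    "\<And>k x. k < 2 ^ j \<Longrightarrow> x = s \<or> x = t \<Longrightarrow>
      ((1 + \<bar>2 ^ j * x - real k\<bar>) / 2 ^ j) powr H j (real k / 2 ^ j) \<le> A * (1 + \<bar>2 ^ j * x - real k\<bar>) powr \<beta>"
  shows "(\<Sum>k<2 ^ j. \<bar>ghbmp_coeff H j k s - ghbmp_coeff H j k t\<bar>) \<le> C * A * (2 ^ j * \<bar>s - t\<bar>) powr \<theta>"
proof -
  have "0 \<le> A \<and> 0 \<le> \<theta> \<and> \<theta> \<le> min 1 (Hlow + 1/2) \<and> \<beta> - 3/2 - \<theta> \<le> - 1 - \<iota> \<and>
     (\<forall>k<2 ^ j. \<forall>x\<in>{s, t}. ((1 + \<bar>2 ^ j * x - real k\<bar>) / 2 ^ j) powr H j (real k / 2 ^ j)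
        \<le> A * (1 + \<bar>2 ^ j * x - real k\<bar>) powr \<beta>)"
    by (intro conjI allI impI ballI assms) auto
  with assms(1)[unfolded increment_constant_def, THEN conjunct2, THEN spec, of A, THEN spec, of \<beta>,
      THEN spec, of \<theta>, THEN spec, of j, THEN spec, of s, THEN spec, of t]
  show ?thesis by (rule mp)
qed

lemma increment_constant_exists:
  assumes "0 < \<iota>"
  shows "\<exists>C. increment_constant \<iota> C"
proof -
  obtain Z where Z: "0 \<le> Z" "\<And>x N. (\<Sum>k<N. (1 + \<bar>x - real k\<bar>) powr (- 1 - \<iota>)) \<le> Z"
    using sum_powr_decay_bounded[OF assms] by blast
  have "increment_constant \<iota> (200000 * Z)"
    unfolding increment_constant_def
  proof (intro conjI allI impI; (elim conjE)?)
    show "0 \<le> 200000 * Z" using Z by simp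
    fix A \<beta> \<theta> :: real and j :: nat and s t :: real
    assume A: "0 \<le> A" and \<theta>: "0 \<le> \<theta>" "\<theta> \<le> min 1 (Hlow + 1/2)" and exp: "\<beta> - 3/2 - \<theta> \<le> - 1 - \<iota>"
      and "\<forall>k<2 ^ j. \<forall>x\<in>{s, t}. ((1 + \<bar>2 ^ j * x - real k\<bar>) / 2 ^ j) powr H j (real k / 2 ^ j)
        \<le> A * (1 + \<bar>2 ^ j * x - real k\<bar>) powr \<beta>"
    then have bound: "((1 + \<bar>2 ^ j * x - real k\<bar>) / 2 ^ j) powr H j (real k / 2 ^ j)
        \<le> A * (1 + \<bar>2 ^ j * x - real k\<bar>) powr \<beta>" if "k < 2 ^ j" "x = s \<or> x = t" for k x
      using that by blast
    define h where "h = (2 ^ j * \<bar>s - t\<bar>) powr \<theta>"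
    define e where "e x k = (1 + \<bar>2 ^ j * x - real k\<bar>) powr (- 1 - \<iota>)" for x k
    have each: "\<bar>ghbmp_coeff H j k s - ghbmp_coeff H j k t\<bar> \<le> 100000 * h * (A * e t k + A * e s k)"
      if k: "k < 2 ^ j" for k
    proof -
      define a where "a = H j (real k / 2 ^ j)"
      have a: "Hlow \<le> a" "a < 1" using H_dyadic[OF k] Hup_less by (auto simp: a_def)
      define y where "y x = 1 + \<bar>2 ^ j * x - real k\<bar>" for x
      have y1: "1 \<le> y x" for x by (simp add: y_def)
      have "2 ^ j * \<bar>s - t\<bar> = \<bar>(2 ^ j * s - real k) - (2 ^ j * t - real k)\<bar>"
        by (simp add: abs_mult right_diff_distrib[symmetric])
      then have h: "h = \<bar>(2 ^ j * s - real k) - (2 ^ j * t - real k)\<bar> powr \<theta>" by (simp add: h_def)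
      have inc: "\<bar>haar_response (a + 1/2) (2 ^ j * s - real k) - haar_response (a + 1/2) (2 ^ j * t - real k)\<bar>
          \<le> 100000 * h * (y t powr (a + 1/2 - 2 - \<theta>) + y s powr (a + 1/2 - 2 - \<theta>))"
        unfolding h y_def using a \<theta> Hlow_pos by (intro haar_response_increment) auto
      \<comment> \<open>Splitting the exponent as a + (- 3/2 - \<theta>) isolates the weight
        \<open>(y x / 2 ^ j) powr a\<close>, which the assumption replaces by
        \<open>A * y x powr \<beta>\<close>.\<close>
      have decay: "2 powr (- real j * a) * y x powr (a + 1/2 - 2 - \<theta>) \<le> A * e x k" if "x = s \<or> x = t" for x
      proof -
        have "2 powr (- real j * a) * y x powr (a + 1/2 - 2 - \<theta>)
            = 2 powr (- real j * a) * y x powr a * y x powr (- 3/2 - \<theta>)"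
          by (simp add: powr_add[symmetric] algebra_simps)
        also have "2 powr (- real j * a) * y x powr a = (y x / 2 ^ j) powr a"
          using y1[of x] by (simp add: powr_divide powr_realpow[symmetric] powr_powr powr_minus_divide)
        also have "\<dots> \<le> A * y x powr \<beta>" using bound[OF k that] by (simp add: y_def a_def)
        also have "A * y x powr \<beta> * y x powr (- 3/2 - \<theta>) = A * y x powr (\<beta> - 3/2 - \<theta>)"
          by (simp add: powr_add[symmetric] algebra_simps)
        also have "\<dots> \<le> A * y x powr (- 1 - \<iota>)"
          using exp A y1[of x] by (intro mult_left_mono powr_mono) auto
        finally show ?thesis by (simp add: e_def y_def mult_right_mono)
      qed
      have "\<bar>ghbmp_coeff H j k s - ghbmp_coeff H j k t\<bar> = 2 powr (- real j * a) *
          \<bar>haar_response (a + 1/2) (2 ^ j * s - real k) - haar_response (a + 1/2) (2 ^ j * t - real k)\<bar>"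
        unfolding coeff_eq[OF k] a_def[symmetric] by (simp add: right_diff_distrib[symmetric] abs_mult)
      also have "\<dots> \<le> 2 powr (- real j * a) *
          (100000 * h * (y t powr (a + 1/2 - 2 - \<theta>) + y s powr (a + 1/2 - 2 - \<theta>)))"
        by (intro mult_left_mono inc) auto
      also have "\<dots> = 100000 * h * (2 powr (- real j * a) * y t powr (a + 1/2 - 2 - \<theta>)
          + 2 powr (- real j * a) * y s powr (a + 1/2 - 2 - \<theta>))"
        by (simp only: distrib_left mult_ac)
      also have "\<dots> \<le> 100000 * h * (A * e t k + A * e s k)"
        by (intro mult_left_mono add_mono decay) (auto simp: h_def)
      finally show ?thesis .
    qed
    have "(\<Sum>k<2 ^ j. \<bar>ghbmp_coeff H j k s - ghbmp_coeff H j k t\<bar>)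
        \<le> (\<Sum>k<2 ^ j. 100000 * h * (A * e t k + A * e s k))"
      by (intro sum_mono each) auto
    also have "\<dots> = 100000 * h * A * ((\<Sum>k<2 ^ j. e t k) + (\<Sum>k<2 ^ j. e s k))"
      by (simp only: sum_distrib_left[symmetric] sum.distrib distrib_left mult.assoc)
    also have "\<dots> \<le> 100000 * h * A * (Z + Z)"
      unfolding e_def using A by (intro mult_left_mono add_mono Z mult_nonneg_nonneg) (auto simp: h_def)
    finally show "(\<Sum>k<2 ^ j. \<bar>ghbmp_coeff H j k s - ghbmp_coeff H j k t\<bar>) \<le> 200000 * Z * A * (2 ^ j * \<bar>s - t\<bar>) powr \<theta>"
      by (simp add: h_def mult_ac)
  qed
  then show ?thesis by blast
qed

text \<open>Provides the base bound required by \<open>powr_le_two_powr\<close>: both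
  \<open>2 ^ j * x\<close> and k lie between 0 and \<open>2 ^ j\<close>.\<close>

lemma scaled_distance_le_two:
  assumes "0 \<le> x" "x \<le> 1" "k < 2 ^ j"
  shows "(1 + \<bar>2 ^ j * x - real k\<bar>) / 2 ^ j \<le> 2"
proof -
  have "real k + 1 \<le> 2 ^ j"
    using assms(3) by (metis Suc_leI of_nat_Suc of_nat_le_iff of_nat_numeral of_nat_power add.commute)
  moreover have "0 \<le> 2 ^ j * x" "2 ^ j * x \<le> 2 ^ j * 1" using assms by (auto intro!: mult_left_mono)
  ultimately have "1 + \<bar>2 ^ j * x - real k\<bar> \<le> 2 * 2 ^ j"
    using one_le_power[of "2::real" j] by linarith
  then show ?thesis by (simp add: divide_le_eq)
qed

lemma coeff_increment_sum_uniform: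
  obtains C where "0 \<le> C"
    "\<And>j s t. \<lbrakk>0 \<le> s; s \<le> 1; 0 \<le> t; t \<le> 1\<rbrakk> \<Longrightarrow>
       (\<Sum>k<2 ^ j. \<bar>ghbmp_coeff H j k s - ghbmp_coeff H j k t\<bar>)
         \<le> C * 2 powr (- (Hlow / 2) * real j) * \<bar>s - t\<bar> powr (Hlow / 2)"
proof -
  have Hlow_less: "Hlow < 1" using H_range[of 0 0] Hup_less by simp
  \<comment> \<open>With these choices \<beta> - 3/2 - \<theta> equals -1 - \<iota> exactly.\<close>
  define \<iota> where "\<iota> = (1 - Hlow) / 2"
  have "0 < \<iota>" using Hlow_less by (simp add: \<iota>_def)
  then obtain C where ic: "increment_constant \<iota> C" using increment_constant_exists by blast
  then have C: "0 \<le> C" by (simp add: increment_constant_def)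
  show ?thesis
  proof (rule that[of "2 * C"])
    show "0 \<le> 2 * C" using C by simp
    fix j :: nat and s t :: real assume st: "0 \<le> s" "s \<le> 1" "0 \<le> t" "t \<le> 1"
    have "(\<Sum>k<2 ^ j. \<bar>ghbmp_coeff H j k s - ghbmp_coeff H j k t\<bar>)
        \<le> C * (2 * 2 powr (- real j * Hlow)) * (2 ^ j * \<bar>s - t\<bar>) powr (Hlow / 2)"
    proof (rule increment_constantD[OF ic])
      fix k :: nat and x :: real assume k: "k < 2 ^ j" and x: "x = s \<or> x = t"
      let ?y = "1 + \<bar>2 ^ j * x - real k\<bar>"
      have "(?y / 2 ^ j) powr H j (real k / 2 ^ j) \<le> 2 * (?y / 2 ^ j) powr Hlow"
      proof (rule powr_le_two_powr)
        show "?y / 2 ^ j \<le> 2" using st x k by (intro scaled_distance_le_two) auto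
      qed (use H_dyadic[OF k] Hup_less Hlow_pos in \<open>auto intro!: divide_pos_pos\<close>)
      also have "(?y / 2 ^ j) powr Hlow = 2 powr (- real j * Hlow) * ?y powr Hlow"
        by (simp add: powr_divide powr_realpow[symmetric] powr_powr powr_minus_divide)
      finally show "(?y / 2 ^ j) powr H j (real k / 2 ^ j) \<le> 2 * 2 powr (- real j * Hlow) * ?y powr Hlow"
        by simp
    qed (use Hlow_pos Hlow_less in \<open>auto simp: \<iota>_def field_simps\<close>)
    also have "(2 ^ j * \<bar>s - t\<bar>) powr (Hlow / 2) = 2 powr (real j * (Hlow / 2)) * \<bar>s - t\<bar> powr (Hlow / 2)"
      by (simp add: powr_mult powr_realpow[symmetric] powr_powr)
    also have "C * (2 * 2 powr (- real j * Hlow)) * (2 powr (real j * (Hlow / 2)) * \<bar>s - t\<bar> powr (Hlow / 2))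
        = 2 * C * (2 powr (- real j * Hlow) * 2 powr (real j * (Hlow / 2))) * \<bar>s - t\<bar> powr (Hlow / 2)"
      by (simp only: mult_ac)
    also have "2 powr (- real j * Hlow) * 2 powr (real j * (Hlow / 2)) = 2 powr (- (Hlow / 2) * real j)"
      by (simp add: powr_add[symmetric] algebra_simps)
    finally show "(\<Sum>k<2 ^ j. \<bar>ghbmp_coeff H j k s - ghbmp_coeff H j k t\<bar>)
         \<le> 2 * C * 2 powr (- (Hlow / 2) * real j) * \<bar>s - t\<bar> powr (Hlow / 2)" .
  qed
qed

text \<open>The Lipschitz constants grow only linearly in j, so over exponentially small distances
  the oscillation drops below the margin \<gamma> - \<beta>.\<close>

lemma H_near:
  assumes t: "0 < t" "t < 1" and ev: "\<forall>\<^sub>F j in sequentially. \<gamma> \<le> H j t" and "\<beta> < \<gamma>" "0 < \<eta>"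
  obtains j0 where "\<And>j x. \<lbrakk>j0 \<le> j; 0 \<le> x; x \<le> 1; \<bar>x - t\<bar> \<le> 2 * 2 powr (- \<eta> * real j)\<rbrakk> \<Longrightarrow> \<beta> \<le> H j x"
proof -
  have "(\<lambda>j. \<bar>C0\<bar> * (1 + real j) * (2 * 2 powr (- \<eta> * real j))) \<longlonglongrightarrow> 0"
    using \<open>0 < \<eta>\<close> by real_asymp
  then have "\<forall>\<^sub>F j in sequentially. \<bar>C0\<bar> * (1 + real j) * (2 * 2 powr (- \<eta> * real j)) < \<gamma> - \<beta>"
    using \<open>\<beta> < \<gamma>\<close> by (intro order_tendstoD) auto
  with ev have "\<forall>\<^sub>F j in sequentially. \<gamma> \<le> H j t \<and> \<bar>C0\<bar> * (1 + real j) * (2 * 2 powr (- \<eta> * real j)) < \<gamma> - \<beta>"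
    by eventually_elim auto
  then obtain j0 where j0: "\<And>j. j0 \<le> j \<Longrightarrow> \<gamma> \<le> H j t \<and> \<bar>C0\<bar> * (1 + real j) * (2 * 2 powr (- \<eta> * real j)) < \<gamma> - \<beta>"
    by (auto simp: eventually_sequentially)
  show ?thesis
  proof (rule that[of j0])
    fix j x assume j: "j0 \<le> j" and x: "0 \<le> x" "x \<le> 1" "\<bar>x - t\<bar> \<le> 2 * 2 powr (- \<eta> * real j)"
    have "\<bar>H j x - H j t\<bar> \<le> C0 * (1 + real j) * \<bar>x - t\<bar>" using x t by (intro H_lipschitz) auto
    also have "\<dots> \<le> \<bar>C0\<bar> * (1 + real j) * (2 * 2 powr (- \<eta> * real j))"
      using x by (intro mult_mono) auto
    finally show "\<beta> \<le> H j x" using j0[OF j] by linarith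
  qed
qed

text \<open>For s within \<open>2 powr (- \<eta> * real j)\<close> of t the exponents near t are at
  least \<beta> and \<theta> = \<alpha> is taken; for s farther away the uniform bound suffices. The
  condition \<alpha> \<le> Hlow + 1/2 makes \<theta> = \<alpha> admissible.\<close>

lemma coeff_increment_sum_local:
  assumes t: "0 < t" "t < 1" and ev: "\<forall>\<^sub>F j in sequentially. \<gamma> \<le> H j t"
    and \<alpha>: "0 \<le> \<alpha>" "\<alpha> < \<gamma>" "\<alpha> \<le> Hlow + 1/2"
  obtains C \<kappa> where "0 \<le> C" "0 < \<kappa>"
    "\<And>j s. \<lbrakk>0 \<le> s; s \<le> 1\<rbrakk> \<Longrightarrow>
       (\<Sum>k<2 ^ j. \<bar>ghbmp_coeff H j k s - ghbmp_coeff H j k t\<bar>) \<le> C * 2 powr (- \<kappa> * real j) * \<bar>s - t\<bar> powr \<alpha>"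
proof -
  have \<gamma>: "\<gamma> < 1"
  proof -
    obtain j where "\<gamma> \<le> H j t" using ev eventually_happens by fastforce
    then show ?thesis using H_range[of t j] t Hup_less by simp
  qed
  \<comment> \<open>In \<alpha> < \<beta>' < \<beta> < \<gamma> the gap \<beta> - \<beta>' pays for
    remote translates and \<beta>' - \<alpha> becomes geometric decay; \<beta> - \<alpha> \<le> 1/4
    gives \<beta> - 3/2 - \<alpha> \<le> -1 - 1/4.\<close>
  define \<beta> where "\<beta> = \<alpha> + min (1/4) ((\<gamma> - \<alpha>) / 2)"
  define \<beta>' where "\<beta>' = (\<alpha> + \<beta>) / 2"
  have \<beta>: "\<alpha> < \<beta>'" "\<beta>' < \<beta>" "0 < \<beta>" "\<beta> < \<gamma>" "\<beta> < 1" "\<beta> \<le> \<alpha> + 1/4"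
  proof -
    define m where "m = min (1/4) ((\<gamma> - \<alpha>) / 2)"
    have m: "0 < m" "m \<le> 1/4" "2 * m \<le> \<gamma> - \<alpha>" by (use \<alpha> in \<open>auto simp: m_def min_def\<close>)
    have \<beta>_eq: "\<beta> = \<alpha> + m" "\<beta>' = \<alpha> + m / 2" by (simp_all add: \<beta>_def \<beta>'_def m_def field_simps)
    show "\<alpha> < \<beta>'" "\<beta>' < \<beta>" "0 < \<beta>" "\<beta> < \<gamma>" "\<beta> < 1" "\<beta> \<le> \<alpha> + 1/4"
      unfolding \<beta>_eq using m \<alpha> \<gamma> by simp_all
  qed
  \<comment> \<open>The first bound serves translates k remote from x, through \<beta>' \<le>
    \<beta> (1 - \<eta>); the second serves points s remote from t, through \<eta> \<le> Hlow /
    4.\<close>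
  define \<eta> where "\<eta> = min ((\<beta> - \<beta>') / \<beta>) (Hlow / 4)"
  have \<eta>: "0 < \<eta>" "\<beta>' \<le> \<beta> * (1 - \<eta>)" "\<eta> \<le> Hlow / 4"
  proof -
    show "0 < \<eta>" using \<beta> Hlow_pos by (simp add: \<eta>_def)
    show "\<eta> \<le> Hlow / 4" unfolding \<eta>_def by (rule min.cobounded2)
    have "\<eta> * \<beta> \<le> (\<beta> - \<beta>') / \<beta> * \<beta>"
      unfolding \<eta>_def using \<beta> by (intro mult_right_mono min.cobounded1) auto
    also have "\<dots> = \<beta> - \<beta>'" using \<beta> by simp
    finally show "\<beta>' \<le> \<beta> * (1 - \<eta>)" by (simp add: algebra_simps)
  qed
  obtain j0 where j0: "\<And>j x. \<lbrakk>j0 \<le> j; 0 \<le> x; x \<le> 1; \<bar>x - t\<bar> \<le> 2 * 2 powr (- \<eta> * real j)\<rbrakk> \<Longrightarrow> \<beta> \<le> H j x"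
    by (rule H_near[OF t ev \<beta>(4) \<eta>(1)]) (rule that)
  obtain C where ic: "increment_constant (1/4) C" using increment_constant_exists[of "1/4"] by auto
  then have C: "0 \<le> C" by (simp add: increment_constant_def)
  obtain D where D: "0 \<le> D"
    "\<And>j s t. \<lbrakk>0 \<le> s; s \<le> 1; 0 \<le> t; t \<le> 1\<rbrakk> \<Longrightarrow>
       (\<Sum>k<2 ^ j. \<bar>ghbmp_coeff H j k s - ghbmp_coeff H j k t\<bar>)
         \<le> D * 2 powr (- (Hlow / 2) * real j) * \<bar>s - t\<bar> powr (Hlow / 2)"
    by (rule coeff_increment_sum_uniform) (rule that)
  \<comment> \<open>The smaller of the decay rates left over in the two cases for s.\<close>
  define \<kappa> where "\<kappa> = min (\<beta>' - \<alpha>) (Hlow / 4)"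
  have \<kappa>: "\<kappa> \<le> \<beta>' - \<alpha>" "\<kappa> \<le> Hlow / 4" unfolding \<kappa>_def by (rule min.cobounded1 min.cobounded2)+
  define B where "B = C * (2 * 2 ^ j0)"
  have B0: "0 \<le> B" using C by (simp add: B_def)
  show ?thesis
  proof (rule that[of "B + D" \<kappa>])
    show "0 \<le> B + D" using B0 D by simp
    show "0 < \<kappa>" using \<beta> Hlow_pos by (simp add: \<kappa>_def)
    fix j :: nat and s :: real assume s: "0 \<le> s" "s \<le> 1"
    let ?S = "\<Sum>k<2 ^ j. \<bar>ghbmp_coeff H j k s - ghbmp_coeff H j k t\<bar>"
    let ?r = "2 powr (- \<kappa> * real j) * \<bar>s - t\<bar> powr \<alpha>"
    have "?S \<le> B * ?r \<or> ?S \<le> D * ?r"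
    proof (cases "\<bar>s - t\<bar> \<le> 2 powr (- \<eta> * real j)")
      case True
      have "?S \<le> C * (2 * 2 ^ j0 * 2 powr (- real j * \<beta>')) * (2 ^ j * \<bar>s - t\<bar>) powr \<alpha>"
      proof (rule increment_constantD[OF ic])
        fix k :: nat and x :: real assume k: "k < 2 ^ j" and x: "x = s \<or> x = t"
        define a where "a = H j (real k / 2 ^ j)"
        define y where "y = 1 + \<bar>2 ^ j * x - real k\<bar>"
        have a: "0 < a" "a < 1" using H_dyadic[OF k] Hlow_pos Hup_less by (auto simp: a_def)
        have y1: "1 \<le> y" by (simp add: y_def)
        have y2: "0 < y / 2 ^ j" "y / 2 ^ j \<le> 2"
          using scaled_distance_le_two[OF _ _ k, of x] x s t y1 by (auto simp: y_def)
        have crude: "(y / 2 ^ j) powr a \<le> 2"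
          using powr_le_two_powr[OF y2, of 0 a] a y1 by simp
        have y\<beta>: "1 \<le> y powr \<beta>" using y1 \<beta> by (intro ge_one_powr_ge_zero) auto
        have j0_pow: "1 \<le> (2::real) ^ j0" by simp
        consider (small) "j < j0" | (near) "j0 \<le> j" "y \<le> 2 powr (real j * (1 - \<eta>))"
          | (far) "2 powr (real j * (1 - \<eta>)) \<le> y" by linarith
        \<comment> \<open>Remote translates may have an exponent \<open>a\<close> below \<open>\<beta>\<close>, but for them \<open>y\<^sup>\<beta>\<close> compensates the factor
          \<open>2\<^bsup>-j\<beta>'\<^esup>\<close>.\<close>
        then have "(y / 2 ^ j) powr a \<le> 2 * (2 ^ j0 * (2 powr (- real j * \<beta>') * y powr \<beta>))"
        proof cases
          case small
          \<comment> \<open>Since \<beta>' < 1, the factor \<open>2 ^ j0\<close> absorbs the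
            finitely many levels at which H is not yet controlled near t.\<close>
          have "1 \<le> 2 powr (real j0 - real j * \<beta>')"
          proof (rule ge_one_powr_ge_zero)
            have "real j * \<beta>' \<le> real j * 1" using \<beta> \<alpha> by (intro mult_left_mono) auto
            then show "0 \<le> real j0 - real j * \<beta>'" using small by simp
          qed simp
          also have "\<dots> = 2 ^ j0 * 2 powr (- real j * \<beta>')"
            by (simp add: powr_realpow[symmetric] powr_add[symmetric])
          finally have "2 * (1 * 1) \<le> 2 * ((2 ^ j0 * 2 powr (- real j * \<beta>')) * y powr \<beta>)"
            using y\<beta> by (intro mult_left_mono mult_mono) auto
          with crude show ?thesis by (simp add: mult.assoc)
        next
          case near
          have "real k / 2 ^ j - x = - (2 ^ j * x - real k) / 2 ^ j" by (simp add: field_simps)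
          then have "\<bar>real k / 2 ^ j - x\<bar> = \<bar>2 ^ j * x - real k\<bar> / 2 ^ j"
            by (simp only: abs_divide abs_minus_cancel) simp
          also have "\<dots> \<le> 2 powr (real j * (1 - \<eta>)) / 2 powr real j"
            using near by (simp add: y_def divide_right_mono powr_realpow)
          also have "\<dots> = 2 powr (- \<eta> * real j)"
            by (simp add: powr_diff[symmetric] algebra_simps)
          \<comment> \<open>The factor 2 in \<open>H_near\<close> is this triangle inequality
            through x, which is s or t.\<close>
          finally have "\<bar>real k / 2 ^ j - t\<bar> \<le> 2 * 2 powr (- \<eta> * real j)"
            using True x by auto
          then have "\<beta> \<le> a" unfolding a_def using near dyadic_unit[OF k] by (intro j0) auto
          then have "(y / 2 ^ j) powr a \<le> 2 * (y / 2 ^ j) powr \<beta>"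
            using y2 a \<beta> by (intro powr_le_two_powr) auto
          also have "(y / 2 ^ j) powr \<beta> = 2 powr (- real j * \<beta>) * y powr \<beta>"
            using y1 by (simp add: powr_divide powr_realpow[symmetric] powr_powr powr_minus_divide)
          also have "\<dots> \<le> 2 ^ j0 * (2 powr (- real j * \<beta>') * y powr \<beta>)"
          proof -
            have "2 powr (- real j * \<beta>) \<le> 2 powr (- real j * \<beta>')"
              using \<beta> by (intro powr_mono) (auto intro: mult_left_mono)
            then have "2 powr (- real j * \<beta>) * y powr \<beta> \<le> 2 powr (- real j * \<beta>') * y powr \<beta>"
              by (intro mult_right_mono) auto
            also have "\<dots> \<le> 2 ^ j0 * (2 powr (- real j * \<beta>') * y powr \<beta>)"
              using mult_right_mono[OF j0_pow, of "2 powr (- real j * \<beta>') * y powr \<beta>"] by simp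
            finally show ?thesis .
          qed
          finally show ?thesis by simp
        next
          case far
          have "2 powr (real j * \<beta>') \<le> 2 powr (real j * (1 - \<eta>) * \<beta>)"
            using \<eta> by (intro powr_mono) (auto simp: mult.assoc mult.commute[of "1 - \<eta>"] intro: mult_left_mono)
          also have "\<dots> = (2 powr (real j * (1 - \<eta>))) powr \<beta>" by (simp add: powr_powr)
          also have "\<dots> \<le> y powr \<beta>" using far \<beta> by (intro powr_mono2) auto
          finally have "2 powr (- real j * \<beta>') * 2 powr (real j * \<beta>') \<le> 2 powr (- real j * \<beta>') * y powr \<beta>"
            by (intro mult_left_mono) auto
          then have "1 \<le> 2 powr (- real j * \<beta>') * y powr \<beta>"
            by (simp add: powr_add[symmetric])
          with j0_pow have "1 * 1 \<le> 2 ^ j0 * (2 powr (- real j * \<beta>') * y powr \<beta>)"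
            by (intro mult_mono) auto
          with crude show ?thesis by simp
        qed
        then show "((1 + \<bar>2 ^ j * x - real k\<bar>) / 2 ^ j) powr H j (real k / 2 ^ j)
            \<le> 2 * 2 ^ j0 * 2 powr (- real j * \<beta>') * (1 + \<bar>2 ^ j * x - real k\<bar>) powr \<beta>"
          by (simp add: y_def a_def mult.assoc)
      qed (use \<alpha> \<beta> in auto)
      also have "(2 ^ j * \<bar>s - t\<bar>) powr \<alpha> = 2 powr (real j * \<alpha>) * \<bar>s - t\<bar> powr \<alpha>"
        by (simp add: powr_mult powr_realpow[symmetric] powr_powr)
      also have "C * (2 * 2 ^ j0 * 2 powr (- real j * \<beta>')) * (2 powr (real j * \<alpha>) * \<bar>s - t\<bar> powr \<alpha>)
          = B * (2 powr (- real j * \<beta>') * 2 powr (real j * \<alpha>)) * \<bar>s - t\<bar> powr \<alpha>"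
        by (simp only: B_def mult_ac)
      also have "2 powr (- real j * \<beta>') * 2 powr (real j * \<alpha>) = 2 powr (- (\<beta>' - \<alpha>) * real j)"
        by (simp add: powr_add[symmetric] algebra_simps)
      also have "B * 2 powr (- (\<beta>' - \<alpha>) * real j) * \<bar>s - t\<bar> powr \<alpha>
          \<le> B * 2 powr (- \<kappa> * real j) * \<bar>s - t\<bar> powr \<alpha>"
        using B0 \<kappa>(1) by (intro mult_right_mono mult_left_mono powr_mono) auto
      finally show ?thesis by (simp add: mult.assoc)
    next
      case False
      \<comment> \<open>Half of the uniform decay is exchanged for
        \<open>\<bar>s - t\<bar> powr \<alpha>\<close>, which uses |s - t| \<le> 1 and \<alpha>
        \<le> 1 \<le> Hlow / 4 / \<eta>; the other half remains.\<close>
      have "2 powr (- (Hlow / 4) * real j) = (2 powr (- \<eta> * real j)) powr (Hlow / 4 / \<eta>)"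
        using \<eta> by (simp add: powr_powr mult.commute)
      also have "\<dots> \<le> \<bar>s - t\<bar> powr (Hlow / 4 / \<eta>)"
        using False \<eta> Hlow_pos by (intro powr_mono2) auto
      also have "\<dots> \<le> \<bar>s - t\<bar> powr \<alpha>"
      proof (rule powr_mono')
        have "\<alpha> \<le> 1" using \<beta> by linarith
        also have "1 \<le> Hlow / 4 / \<eta>" using \<eta> by (simp add: le_divide_eq)
        finally show "\<alpha> \<le> Hlow / 4 / \<eta>" .
      qed (use s t in auto)
      finally have far: "2 powr (- (Hlow / 4) * real j) \<le> \<bar>s - t\<bar> powr \<alpha>" .
      have "?S \<le> D * 2 powr (- (Hlow / 2) * real j) * \<bar>s - t\<bar> powr (Hlow / 2)"
        using s t by (intro D) auto
      also have "\<dots> \<le> D * 2 powr (- (Hlow / 2) * real j) * 1 powr (Hlow / 2)"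
        using s t D Hlow_pos by (intro mult_left_mono powr_mono2) auto
      also have "\<dots> = D * (2 powr (- (Hlow / 4) * real j) * 2 powr (- (Hlow / 4) * real j))"
        by (simp add: powr_add[symmetric])
      also have "\<dots> \<le> D * ?r"
      proof -
        have "2 powr (- (Hlow / 4) * real j) \<le> 2 powr (- \<kappa> * real j)"
          using \<kappa>(2) by (intro powr_mono mult_right_mono) auto
        then show ?thesis using far by (intro mult_left_mono[OF _ D(1)] mult_mono) auto
      qed
      finally show ?thesis by simp
    qed
    moreover have "0 \<le> ?r" by simp
    ultimately have "?S \<le> (B + D) * ?r"
      unfolding distrib_right using mult_nonneg_nonneg[OF B0, of ?r] mult_nonneg_nonneg[OF D(1), of ?r] by linarith
    then show "?S \<le> (B + D) * 2 powr (- \<kappa> * real j) * \<bar>s - t\<bar> powr \<alpha>" by (simp only: mult.assoc)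
  qed
qed

end

section \<open>The series for a fixed realisation of the noise\<close>

lemma holder_imp_continuous_on:
  fixes f :: "real \<Rightarrow> real"
  assumes "0 < a" and "\<And>s t. s \<in> S \<Longrightarrow> t \<in> S \<Longrightarrow> \<bar>f s - f t\<bar> \<le> D * \<bar>s - t\<bar> powr a"
  shows "continuous_on S f"
  unfolding continuous_on_def
proof
  fix t assume t: "t \<in> S"
  have "((\<lambda>s. D * \<bar>s - t\<bar> powr a) \<longlongrightarrow> D * \<bar>t - t\<bar> powr a) (at t within S)"
    using assms(1) by (intro tendsto_mult tendsto_powr' tendsto_rabs tendsto_diff tendsto_ident_at tendsto_const) auto
  then have lim: "((\<lambda>s. D * \<bar>s - t\<bar> powr a) \<longlongrightarrow> 0) (at t within S)" by simp
  have "\<forall>\<^sub>F s in at t within S. norm (f s - f t) \<le> D * \<bar>s - t\<bar> powr a"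
    using assms(2) t by (auto simp: eventually_at_filter)
  from Lim_null_comparison[OF this lim] show "(f \<longlongrightarrow> f t) (at t within S)"
    by (simp add: LIM_zero_iff)
qed

text \<open>Half of the decay absorbs the linear factor, the other half is geometric.\<close>

lemma summable_linear_times_exponential:
  fixes \<kappa> :: real
  assumes "0 < \<kappa>"
  shows "summable (\<lambda>j. (1 + real j) * 2 powr (- \<kappa> * real j))"
proof (rule summable_comparison_test_bigo)
  have "2 powr (- \<kappa> / 2) < (1::real)" using powr_less_mono[of "- \<kappa> / 2" 0 2] assms by simp
  then have "summable (\<lambda>j. (2 powr (- \<kappa> / 2)) ^ j :: real)" by (intro summable_geometric) simp
  then show "summable (\<lambda>j. norm (2 powr (- (\<kappa> / 2) * real j) :: real))"
    by (simp add: powr_realpow[symmetric] powr_powr)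
  show "(\<lambda>j. (1 + real j) * 2 powr (- \<kappa> * real j)) \<in> O(\<lambda>j. 2 powr (- (\<kappa> / 2) * real j))"
    using assms by real_asymp
qed

context hurst_sequence begin

definition level_sum :: "(nat \<Rightarrow> nat \<Rightarrow> real) \<Rightarrow> nat \<Rightarrow> real \<Rightarrow> real" where
  "level_sum e j t = (\<Sum>k<2 ^ j. ghbmp_coeff H j k t * e j k)"

text \<open>A growth that the noise satisfies almost surely and that geometric decay in the level
  still beats.\<close>

definition linear_growth :: "(nat \<Rightarrow> nat \<Rightarrow> real) \<Rightarrow> bool" where
  "linear_growth e \<longleftrightarrow> (\<exists>K\<ge>0. \<forall>j. \<forall>k<2 ^ j. \<bar>e j k\<bar> \<le> K * (1 + real j))"

lemma coeff_at_zero: "k < 2 ^ j \<Longrightarrow> ghbmp_coeff H j k 0 = 0"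
  by (simp add: coeff_eq haar_response_nonpos)

lemma level_sum_at_zero: "level_sum e j 0 = 0"
  unfolding level_sum_def by (intro sum.neutral) (simp add: coeff_at_zero)

lemma level_sum_increment_le:
  assumes "\<And>k. k < 2 ^ j \<Longrightarrow> \<bar>e j k\<bar> \<le> K * (1 + real j)"
    and "(\<Sum>k<2 ^ j. \<bar>ghbmp_coeff H j k s - ghbmp_coeff H j k t\<bar>) \<le> S" and "0 \<le> K"
  shows "\<bar>level_sum e j s - level_sum e j t\<bar> \<le> K * (1 + real j) * S"
proof -
  have "level_sum e j s - level_sum e j t = (\<Sum>k<2 ^ j. (ghbmp_coeff H j k s - ghbmp_coeff H j k t) * e j k)"
    by (simp add: level_sum_def sum_subtractf left_diff_distrib)
  also have "\<bar>\<dots>\<bar> \<le> (\<Sum>k<2 ^ j. \<bar>ghbmp_coeff H j k s - ghbmp_coeff H j k t\<bar> * (K * (1 + real j)))"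
    using assms(1) by (intro order.trans[OF sum_abs] sum_mono) (simp add: abs_mult mult_left_mono)
  also have "\<dots> = (\<Sum>k<2 ^ j. \<bar>ghbmp_coeff H j k s - ghbmp_coeff H j k t\<bar>) * (K * (1 + real j))"
    by (rule sum_distrib_right[symmetric])
  also have "\<dots> \<le> S * (K * (1 + real j))"
    using assms by (intro mult_right_mono) auto
  finally show ?thesis by (simp only: mult_ac)
qed

text \<open>The coefficients vanish at 0, so the increment bound from 0 to t controls the value at
  t.\<close>

lemma level_sum_summable:
  assumes "linear_growth e" "0 \<le> t" "t \<le> 1"
  shows "summable (\<lambda>j. level_sum e j t)"
proof -
  obtain K where K: "0 \<le> K" "\<And>j k. k < 2 ^ j \<Longrightarrow> \<bar>e j k\<bar> \<le> K * (1 + real j)"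
    using assms(1) by (auto simp: linear_growth_def)
  obtain C where C: "0 \<le> C"
    "\<And>j s t. \<lbrakk>0 \<le> s; s \<le> 1; 0 \<le> t; t \<le> 1\<rbrakk> \<Longrightarrow>
       (\<Sum>k<2 ^ j. \<bar>ghbmp_coeff H j k s - ghbmp_coeff H j k t\<bar>)
         \<le> C * 2 powr (- (Hlow / 2) * real j) * \<bar>s - t\<bar> powr (Hlow / 2)"
    by (rule coeff_increment_sum_uniform) (rule that)
  have "\<bar>level_sum e j t - level_sum e j 0\<bar>
      \<le> K * (1 + real j) * (C * 2 powr (- (Hlow / 2) * real j) * \<bar>t - 0\<bar> powr (Hlow / 2))" for j
    using assms K by (intro level_sum_increment_le C) auto
  then have "norm (level_sum e j t) \<le> K * C * \<bar>t\<bar> powr (Hlow / 2) * ((1 + real j) * 2 powr (- (Hlow / 2) * real j))" for j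
    unfolding level_sum_at_zero by (simp add: mult_ac)
  moreover have "summable (\<lambda>j. K * C * \<bar>t\<bar> powr (Hlow / 2) * ((1 + real j) * 2 powr (- (Hlow / 2) * real j)))"
    using Hlow_pos by (intro summable_mult summable_linear_times_exponential) simp
  ultimately show ?thesis by (rule summable_comparison_test'[rotated])
qed

text \<open>D is chosen before s and t, while the coefficient bound is required per pair; this
  serves the uniform estimate as well as the one at a fixed t.\<close>

lemma suminf_increment_le:
  assumes e: "linear_growth e" and "0 < \<kappa>" and "0 \<le> C"
  obtains D where "\<And>s t. \<lbrakk>0 \<le> s; s \<le> 1; 0 \<le> t; t \<le> 1;
      \<And>j. (\<Sum>k<2 ^ j. \<bar>ghbmp_coeff H j k s - ghbmp_coeff H j k t\<bar>) \<le> C * 2 powr (- \<kappa> * real j) * \<bar>s - t\<bar> powr \<alpha>\<rbrakk>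
    \<Longrightarrow> \<bar>(\<Sum>j. level_sum e j s) - (\<Sum>j. level_sum e j t)\<bar> \<le> D * \<bar>s - t\<bar> powr \<alpha>"
proof -
  obtain K where K: "0 \<le> K" "\<And>j k. k < 2 ^ j \<Longrightarrow> \<bar>e j k\<bar> \<le> K * (1 + real j)"
    using e by (auto simp: linear_growth_def)
  define g where "g j = (1 + real j) * 2 powr (- \<kappa> * real j)" for j
  have g: "summable g" unfolding g_def using assms by (intro summable_linear_times_exponential)
  show ?thesis
  proof (rule that[of "K * C * suminf g"])
    fix s t assume st: "0 \<le> s" "s \<le> 1" "0 \<le> t" "t \<le> 1"
      and bound: "\<And>j. (\<Sum>k<2 ^ j. \<bar>ghbmp_coeff H j k s - ghbmp_coeff H j k t\<bar>) \<le> C * 2 powr (- \<kappa> * real j) * \<bar>s - t\<bar> powr \<alpha>"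
    have sum: "summable (\<lambda>j. level_sum e j s)" "summable (\<lambda>j. level_sum e j t)"
      using e st by (auto intro: level_sum_summable)
    have "norm (level_sum e j s - level_sum e j t) \<le> K * C * \<bar>s - t\<bar> powr \<alpha> * g j" for j
      using level_sum_increment_le[of j e K s t, OF K(2) bound K(1)] by (simp add: g_def mult_ac)
    then have "norm (\<Sum>j. level_sum e j s - level_sum e j t) \<le> (\<Sum>j. K * C * \<bar>s - t\<bar> powr \<alpha> * g j)"
      by (intro norm_suminf_le summable_mult g)
    also have "\<dots> = K * C * suminf g * \<bar>s - t\<bar> powr \<alpha>"
      by (subst suminf_mult[OF g]) (simp only: mult_ac)
    finally show "\<bar>(\<Sum>j. level_sum e j s) - (\<Sum>j. level_sum e j t)\<bar> \<le> K * C * suminf g * \<bar>s - t\<bar> powr \<alpha>"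
      using sum by (simp add: suminf_diff)
  qed
qed

text \<open>Continuity lets the agreement of the process with the series spread from a countable
  dense set to [0,1].\<close>

lemma series_continuous:
  assumes "linear_growth e"
  shows "continuous_on {0..1} (\<lambda>t. \<Sum>j. level_sum e j t)"
proof -
  obtain C where C: "0 \<le> C"
    "\<And>j s t. \<lbrakk>0 \<le> s; s \<le> 1; 0 \<le> t; t \<le> 1\<rbrakk> \<Longrightarrow>
       (\<Sum>k<2 ^ j. \<bar>ghbmp_coeff H j k s - ghbmp_coeff H j k t\<bar>)
         \<le> C * 2 powr (- (Hlow / 2) * real j) * \<bar>s - t\<bar> powr (Hlow / 2)"
    by (rule coeff_increment_sum_uniform) (rule that)
  have "0 < Hlow / 2" using Hlow_pos by simp
  show ?thesis
  proof (rule suminf_increment_le[OF assms \<open>0 < Hlow / 2\<close> C(1), of "Hlow / 2"])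
    fix D assume D: "\<And>s t. \<lbrakk>0 \<le> s; s \<le> 1; 0 \<le> t; t \<le> 1;
      \<And>j. (\<Sum>k<2 ^ j. \<bar>ghbmp_coeff H j k s - ghbmp_coeff H j k t\<bar>) \<le> C * 2 powr (- (Hlow / 2) * real j) * \<bar>s - t\<bar> powr (Hlow / 2)\<rbrakk>
      \<Longrightarrow> \<bar>(\<Sum>j. level_sum e j s) - (\<Sum>j. level_sum e j t)\<bar> \<le> D * \<bar>s - t\<bar> powr (Hlow / 2)"
    show ?thesis
    proof (rule holder_imp_continuous_on[OF \<open>0 < Hlow / 2\<close>])
      fix s t :: real assume "s \<in> {0..1}" "t \<in> {0..1}"
      then show "\<bar>(\<Sum>j. level_sum e j s) - (\<Sum>j. level_sum e j t)\<bar> \<le> D * \<bar>s - t\<bar> powr (Hlow / 2)"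
        by (intro D C) auto
    qed
  qed
qed

lemma series_holder_at:
  assumes e: "linear_growth e" and t: "0 < t" "t < 1" and ev: "\<forall>\<^sub>F j in sequentially. \<gamma> \<le> H j t"
    and \<alpha>: "0 \<le> \<alpha>" "\<alpha> < \<gamma>" "\<alpha> \<le> Hlow + 1/2"
  obtains D where "\<And>s. \<lbrakk>0 \<le> s; s \<le> 1\<rbrakk> \<Longrightarrow>
    \<bar>(\<Sum>j. level_sum e j s) - (\<Sum>j. level_sum e j t)\<bar> \<le> D * \<bar>s - t\<bar> powr \<alpha>"
proof -
  obtain C \<kappa> where C: "0 \<le> C" "0 < \<kappa>"
    "\<And>j s. \<lbrakk>0 \<le> s; s \<le> 1\<rbrakk> \<Longrightarrow>
       (\<Sum>k<2 ^ j. \<bar>ghbmp_coeff H j k s - ghbmp_coeff H j k t\<bar>) \<le> C * 2 powr (- \<kappa> * real j) * \<bar>s - t\<bar> powr \<alpha>"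
    by (rule coeff_increment_sum_local[OF t ev \<alpha>]) (rule that)
  show ?thesis
  proof (rule suminf_increment_le[OF e C(2,1), of \<alpha>])
    fix D assume D: "\<And>s t. \<lbrakk>0 \<le> s; s \<le> 1; 0 \<le> t; t \<le> 1;
      \<And>j. (\<Sum>k<2 ^ j. \<bar>ghbmp_coeff H j k s - ghbmp_coeff H j k t\<bar>) \<le> C * 2 powr (- \<kappa> * real j) * \<bar>s - t\<bar> powr \<alpha>\<rbrakk>
      \<Longrightarrow> \<bar>(\<Sum>j. level_sum e j s) - (\<Sum>j. level_sum e j t)\<bar> \<le> D * \<bar>s - t\<bar> powr \<alpha>"
    show thesis
    proof (rule that[of D])
      fix s :: real assume "0 \<le> s" "s \<le> 1"
      then show "\<bar>(\<Sum>j. level_sum e j s) - (\<Sum>j. level_sum e j t)\<bar> \<le> D * \<bar>s - t\<bar> powr \<alpha>"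
        using t by (intro D C) auto
    qed
  qed
qed

end

section \<open>Gaussian estimates\<close>

text \<open>Exponential tilting: \<open>e\<^bsup>2z\<^esup>\<close> times the standard normal density is \<open>e\<^sup>2\<close> times the density centred at \<open>2\<close>.\<close>

lemma std_normal_density_le_shifted:
  assumes "x \<le> \<bar>z\<bar>"
  shows "std_normal_density z \<le> exp (2 - 2 * x) * (normal_density 2 1 z + normal_density (- 2) 1 z)"
proof -
  have shift: "normal_density m 1 z = exp (m * z - m\<^sup>2 / 2) * std_normal_density z" for m
    unfolding normal_density_def
    by (simp add: exp_add[symmetric] power2_eq_square algebra_simps diff_divide_distrib add_divide_distrib)
  have "1 \<le> exp (2 - 2 * x) * (exp (2 * z - 2) + exp (- 2 * z - 2))"
  proof -
    have "1 \<le> exp (2 * \<bar>z\<bar> - 2 * x)" using assms by simp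
    also have "\<dots> \<le> exp (2 * z - 2 * x) + exp (- 2 * z - 2 * x)" by (cases "0 \<le> z") simp_all
    also have "\<dots> = exp (2 - 2 * x) * (exp (2 * z - 2) + exp (- 2 * z - 2))"
      unfolding distrib_left mult_exp_exp by (intro arg_cong2[where f = "(+)"] arg_cong[where f = exp]) simp_all
    finally show ?thesis .
  qed
  then have "1 * std_normal_density z \<le> exp (2 - 2 * x) * (exp (2 * z - 2) + exp (- 2 * z - 2)) * std_normal_density z"
    by (rule mult_right_mono) simp
  then show ?thesis unfolding shift[of 2] shift[of "-2"] by (simp add: algebra_simps)
qed

text \<open>Exponential decay at rate 2 is enough: at x = j it beats the 2^j variables of level j,
  because 2 exp(-2) < 1.\<close>

lemma (in prob_space) std_normal_tail:
  assumes "distributed M lborel Z std_normal_density"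
  shows "prob {\<omega>\<in>space M. x \<le> \<bar>Z \<omega>\<bar>} \<le> 2 * exp (2 - 2 * x)"
proof -
  have "emeasure M {\<omega>\<in>space M. x \<le> \<bar>Z \<omega>\<bar>} = emeasure M (Z -` {z. x \<le> \<bar>z\<bar>} \<inter> space M)"
    by (intro arg_cong[where f = "emeasure M"]) auto
  also have "\<dots> = (\<integral>\<^sup>+z. ennreal (std_normal_density z) * indicator {z. x \<le> \<bar>z\<bar>} z \<partial>lborel)"
    by (rule distributed_emeasure[OF assms]) simp
  also have "\<dots> \<le> (\<integral>\<^sup>+z. ennreal (exp (2 - 2 * x)) * (ennreal (normal_density 2 1 z) + ennreal (normal_density (- 2) 1 z)) \<partial>lborel)"
  proof (rule nn_integral_mono)
    fix z :: real
    show "ennreal (std_normal_density z) * indicator {z. x \<le> \<bar>z\<bar>} z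
      \<le> ennreal (exp (2 - 2 * x)) * (ennreal (normal_density 2 1 z) + ennreal (normal_density (- 2) 1 z))"
    proof (cases "x \<le> \<bar>z\<bar>")
      case True
      then show ?thesis
        using std_normal_density_le_shifted[OF True]
        by (simp add: ennreal_mult[symmetric] ennreal_plus[symmetric] ennreal_leI del: ennreal_plus)
    qed simp
  qed
  also have "\<dots> = ennreal (exp (2 - 2 * x)) * (1 + 1)"
  proof -
    have "(\<integral>\<^sup>+z. ennreal (normal_density m 1 z) \<partial>lborel) = 1" for m
      using prob_space.emeasure_space_1[OF prob_space_normal_density[of 1 m]]
      by (simp add: emeasure_density)
    then show ?thesis by (simp add: nn_integral_cmult nn_integral_add)
  qed
  also have "\<dots> = ennreal (2 * exp (2 - 2 * x))"
    by (simp add: ennreal_mult'' mult.commute)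
  finally show ?thesis by (simp add: emeasure_eq_measure)
qed

text \<open>Borel-Cantelli over the levels: from some level on no variable of level j reaches j in
  modulus, and the finitely many earlier ones are absorbed into K.\<close>

lemma (in prob_space) std_gaussian_family_linear_growth:
  assumes "std_gaussian_family M \<epsilon>"
  shows "AE \<omega> in M. \<exists>K\<ge>0. \<forall>j. \<forall>k<2 ^ j. \<bar>\<epsilon> j k \<omega>\<bar> \<le> K * (1 + real j)"
proof -
  have dist: "distributed M lborel (\<epsilon> j k) std_normal_density" if "k < 2 ^ j" for j k
    using assms that by (auto simp: std_gaussian_family_def)
  then have [measurable]: "\<epsilon> j k \<in> borel_measurable M" if "k < 2 ^ j" for j k
    using that by (auto simp: distributed_def)
  define A where "A j = (\<Union>k<2 ^ j. {\<omega>\<in>space M. real j \<le> \<bar>\<epsilon> j k \<omega>\<bar>})" for j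
  have A: "A j \<in> events" for j unfolding A_def by (intro sets.finite_UN) auto
  have bound: "prob (A j) \<le> 2 * exp 2 * (2 * exp (- 2)) ^ j" for j
  proof -
    have "prob (A j) \<le> (\<Sum>k<2 ^ j. prob {\<omega>\<in>space M. real j \<le> \<bar>\<epsilon> j k \<omega>\<bar>})"
      unfolding A_def by (intro finite_measure_subadditive_finite) auto
    also have "\<dots> \<le> (\<Sum>k<(2 ^ j :: nat). 2 * exp (2 - 2 * real j))"
      by (intro sum_mono std_normal_tail dist) auto
    also have "\<dots> = 2 * exp 2 * (2 * exp (- 2)) ^ j"
      by (simp add: power_mult_distrib exp_of_nat_mult[symmetric] exp_diff exp_minus field_simps)
    finally show ?thesis .
  qed
  have "exp (- 2 :: real) \<le> inverse 3"
    unfolding exp_minus using exp_ge_add_one_self[of 2] by (intro le_imp_inverse_le) auto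
  then have "summable (\<lambda>j. 2 * exp 2 * (2 * exp (- 2 :: real)) ^ j)"
    by (intro summable_mult summable_geometric) auto
  then have "summable (\<lambda>j. prob (A j))"
    by (rule summable_comparison_test[rotated]) (use bound in auto)
  then have "AE \<omega> in M. eventually (\<lambda>j. \<omega> \<in> space M - A j) sequentially"
    by (intro borel_cantelli_AE1 A) (simp add: emeasure_eq_measure)
  then show ?thesis
  proof eventually_elim
    fix \<omega> assume "eventually (\<lambda>j. \<omega> \<in> space M - A j) sequentially"
    then obtain j0 where j0: "\<And>j. j0 \<le> j \<Longrightarrow> \<omega> \<in> space M - A j"
      by (auto simp: eventually_sequentially)
    define K where "K = 1 + (\<Sum>j<j0. \<Sum>k<2 ^ j. \<bar>\<epsilon> j k \<omega>\<bar>)"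
    have S0: "0 \<le> (\<Sum>j<j0. \<Sum>k<2 ^ j. \<bar>\<epsilon> j k \<omega>\<bar>)" by (intro sum_nonneg) auto
    have K1: "1 \<le> K" using S0 by (simp add: K_def)
    have "\<bar>\<epsilon> j k \<omega>\<bar> \<le> K * (1 + real j)" if k: "k < 2 ^ j" for j k
    proof (cases "j < j0")
      case True
      have "\<bar>\<epsilon> j k \<omega>\<bar> \<le> (\<Sum>k<2 ^ j. \<bar>\<epsilon> j k \<omega>\<bar>)"
        using k by (intro member_le_sum) auto
      also have "\<dots> \<le> (\<Sum>j<j0. \<Sum>k<2 ^ j. \<bar>\<epsilon> j k \<omega>\<bar>)"
        using True by (intro member_le_sum[of j _ "\<lambda>j. \<Sum>k<2 ^ j. \<bar>\<epsilon> j k \<omega>\<bar>"] sum_nonneg) auto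
      also have "\<dots> \<le> K * 1" by (simp add: K_def)
      also have "\<dots> \<le> K * (1 + real j)" using K1 by (intro mult_left_mono) auto
      finally show ?thesis .
    next
      case False
      then have "\<bar>\<epsilon> j k \<omega>\<bar> \<le> 1 * (1 + real j)" using j0[of j] k by (force simp: A_def)
      also have "\<dots> \<le> K * (1 + real j)" using K1 by (intro mult_right_mono) auto
      finally show ?thesis .
    qed
    with K1 show "\<exists>K\<ge>0. \<forall>j. \<forall>k<2 ^ j. \<bar>\<epsilon> j k \<omega>\<bar> \<le> K * (1 + real j)"
      by (intro exI[of _ K]) auto
  qed
qed

text \<open>By Fubini \<open>U\<close> may be frozen. The event then confines a standard normal
  variable to an interval of length 2 r / c, wherever \<open>a (U \<omega>)\<close> places its
  centre.\<close>

lemma (in prob_space) indep_std_normal_small_ball: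
  assumes ind: "indep_var S U T W" and v: "v \<in> borel_measurable T"
    and V: "distributed M lborel (\<lambda>\<omega>. v (W \<omega>)) std_normal_density"
    and F: "F \<in> sets S" and a: "a \<in> borel_measurable S" and c: "0 < c" and r: "0 \<le> r"
  shows "prob {\<omega>\<in>space M. U \<omega> \<in> F \<and> \<bar>a (U \<omega>) + c * v (W \<omega>)\<bar> \<le> r} \<le> prob {\<omega>\<in>space M. U \<omega> \<in> F} * (r / c)"
proof -
  have U[measurable]: "random_variable S U" and W[measurable]: "random_variable T W"
    and joint: "distr M S U \<Otimes>\<^sub>M distr M T W = distr M (S \<Otimes>\<^sub>M T) (\<lambda>\<omega>. (U \<omega>, W \<omega>))"
    using ind by (auto simp: indep_var_distribution_eq)
  note [measurable] = F a v
  interpret W: prob_space "distr M T W" by (rule prob_space_distr) simp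
  have slice: "emeasure (distr M T W) {w\<in>space T. \<bar>b + c * v w\<bar> \<le> r} \<le> ennreal (r / c)" for b
  proof -
    have "emeasure (distr M T W) {w\<in>space T. \<bar>b + c * v w\<bar> \<le> r}
        = emeasure M (W -` {w\<in>space T. \<bar>b + c * v w\<bar> \<le> r} \<inter> space M)"
      by (rule emeasure_distr) measurable
    also have "\<dots> = emeasure M ((\<lambda>\<omega>. v (W \<omega>)) -` {v. \<bar>b + c * v\<bar> \<le> r} \<inter> space M)"
      using measurable_space[OF W] by (intro arg_cong[where f = "emeasure M"]) auto
    also have "\<dots> = (\<integral>\<^sup>+v. ennreal (std_normal_density v) * indicator {v. \<bar>b + c * v\<bar> \<le> r} v \<partial>lborel)"
      by (rule distributed_emeasure[OF V]) simp
    also have "\<dots> \<le> (\<integral>\<^sup>+v. ennreal (1/2) * indicator {(- r - b) / c..(r - b) / c} v \<partial>lborel)"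
    proof (rule nn_integral_mono)
      fix v :: real
      have "std_normal_density v \<le> 1 / sqrt (2 * pi)"
        by (simp add: std_normal_density_def divide_right_mono)
      \<comment> \<open>A density of at most 1/2 gives such an interval mass at most r / c.\<close>
      also have "\<dots> \<le> 1 / sqrt 4" using pi_gt3 by (intro divide_left_mono real_sqrt_le_mono) auto
      finally have "std_normal_density v \<le> 1/2" by simp
      then have "ennreal (std_normal_density v) \<le> ennreal (1/2)" by (rule ennreal_leI)
      moreover have "v \<in> {(- r - b) / c..(r - b) / c}" if "\<bar>b + c * v\<bar> \<le> r"
        using that c by (auto simp: abs_le_iff field_simps)
      ultimately show "ennreal (std_normal_density v) * indicator {v. \<bar>b + c * v\<bar> \<le> r} v
          \<le> ennreal (1/2) * indicator {(- r - b) / c..(r - b) / c} v"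
        by (auto simp: indicator_def)
    qed
    also have "\<dots> = ennreal (1/2) * ennreal ((r - b) / c - (- r - b) / c)"
      using c r by (subst nn_integral_cmult_indicator) (auto simp: divide_right_mono)
    also have "\<dots> = ennreal (r / c)"
      using c r by (subst ennreal_mult[symmetric]) (auto simp: field_simps)
    finally show ?thesis .
  qed
  define B where "B = {p \<in> space (S \<Otimes>\<^sub>M T). fst p \<in> F \<and> \<bar>a (fst p) + c * v (snd p)\<bar> \<le> r}"
  have B: "B \<in> sets (S \<Otimes>\<^sub>M T)" unfolding B_def by measurable
  have "emeasure M {\<omega>\<in>space M. U \<omega> \<in> F \<and> \<bar>a (U \<omega>) + c * v (W \<omega>)\<bar> \<le> r}
      = emeasure M ((\<lambda>\<omega>. (U \<omega>, W \<omega>)) -` B \<inter> space M)"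
    using measurable_space[OF U] measurable_space[OF W] by (intro arg_cong[where f = "emeasure M"]) (auto simp: B_def space_pair_measure)
  also have "\<dots> = emeasure (distr M S U \<Otimes>\<^sub>M distr M T W) B"
    unfolding joint using B by (subst emeasure_distr) auto
  also have "\<dots> = (\<integral>\<^sup>+u. emeasure (distr M T W) (Pair u -` B) \<partial>distr M S U)"
    using B by (intro W.emeasure_pair_measure_alt) (simp cong: sets_pair_measure_cong)
  also have "\<dots> \<le> (\<integral>\<^sup>+u. ennreal (r / c) * indicator F u \<partial>distr M S U)"
  proof (rule nn_integral_mono)
    fix u assume "u \<in> space (distr M S U)"
    have "Pair u -` B \<subseteq> {w\<in>space T. \<bar>a u + c * v w\<bar> \<le> r}" "u \<notin> F \<Longrightarrow> Pair u -` B = {}"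
      by (auto simp: B_def space_pair_measure)
    moreover have "{w\<in>space T. \<bar>a u + c * v w\<bar> \<le> r} \<in> sets (distr M T W)" by simp
    ultimately show "emeasure (distr M T W) (Pair u -` B) \<le> ennreal (r / c) * indicator F u"
      using order.trans[OF emeasure_mono slice[of "a u"]] by (cases "u \<in> F") auto
  qed
  also have "\<dots> = ennreal (r / c) * emeasure (distr M S U) F"
    by (rule nn_integral_cmult_indicator) simp
  also have "emeasure (distr M S U) F = emeasure M {\<omega>\<in>space M. U \<omega> \<in> F}"
    by (subst emeasure_distr) (auto intro!: arg_cong[where f = "emeasure M"])
  also have "ennreal (r / c) * \<dots> = ennreal (prob {\<omega>\<in>space M. U \<omega> \<in> F} * (r / c))"
    using c r by (subst emeasure_eq_measure, subst ennreal_mult[symmetric]) (auto simp: mult.commute)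
  finally show ?thesis
    using c r by (simp add: emeasure_eq_measure)
qed

text \<open>Induction on N: the last pivot \<open>p N\<close> has coefficient 0 in all earlier sums,
  so the first N conditions depend on the other variables only, and conditioning on those
  contributes the factor \<open>r N / d N (p N)\<close>.\<close>

lemma (in prob_space) triangular_small_ball:
  fixes Z :: "'i \<Rightarrow> 'a \<Rightarrow> real" and d :: "nat \<Rightarrow> 'i \<Rightarrow> real"
  assumes "finite I" and "indep_vars (\<lambda>_. borel) Z I"
    and "\<And>i. i \<in> I \<Longrightarrow> distributed M lborel (Z i) std_normal_density"
    and "inj_on p {..<N}" and "p ` {..<N} \<subseteq> I"
    and "\<And>m. m < N \<Longrightarrow> 0 < d m (p m)" and "\<And>m n. m < n \<Longrightarrow> n < N \<Longrightarrow> d m (p n) = 0"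
    and "\<And>m. m < N \<Longrightarrow> 0 \<le> r m"
  shows "prob {\<omega>\<in>space M. \<forall>m<N. \<bar>\<Sum>i\<in>I. d m i * Z i \<omega>\<bar> \<le> r m} \<le> (\<Prod>m<N. r m / d m (p m))"
  using assms(4-8)
proof (induction N)
  case 0
  then show ?case by simp
next
  case (Suc N)
  define I' where "I' = I - {p N}"
  have pN: "p N \<in> I" using Suc.prems(2) by auto
  have I: "I = insert (p N) I'" "p N \<notin> I'" "finite I'" using pN assms(1) by (auto simp: I'_def)
  define S where "S = PiM I' (\<lambda>_. borel :: real measure)"
  define U where "U = (\<lambda>\<omega>. restrict (\<lambda>i. Z i \<omega>) I')"
  define a where "a m u = (\<Sum>i\<in>I'. d m i * u i)" for m and u :: "'i \<Rightarrow> real"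
  define F where "F = {u\<in>space S. \<forall>m<N. \<bar>a m u\<bar> \<le> r m}"
  have a_meas [measurable]: "a m \<in> borel_measurable S" for m
    unfolding a_def S_def by measurable
  have F: "F \<in> sets S" unfolding F_def by measurable
  have split: "(\<Sum>i\<in>I. d m i * Z i \<omega>) = a m (U \<omega>) + d m (p N) * Z (p N) \<omega>" for m \<omega>
    using I by (simp add: a_def U_def)
  have ind: "indep_var S U (PiM {p N} (\<lambda>_. borel)) (\<lambda>\<omega>. restrict (\<lambda>i. Z i \<omega>) {p N})"
    unfolding S_def U_def using I by (intro indep_var_restrict[OF assms(2)]) auto
  have U_space: "U \<omega> \<in> space S" for \<omega> by (simp add: U_def S_def space_PiM)
  have below: "{\<omega>\<in>space M. U \<omega> \<in> F} = {\<omega>\<in>space M. \<forall>m<N. \<bar>\<Sum>i\<in>I. d m i * Z i \<omega>\<bar> \<le> r m}"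
    using U_space Suc.prems(4)[of _ N] by (auto simp: F_def split)
  have "{\<omega>\<in>space M. \<forall>m<Suc N. \<bar>\<Sum>i\<in>I. d m i * Z i \<omega>\<bar> \<le> r m}
      = {\<omega>\<in>space M. U \<omega> \<in> F \<and> \<bar>a N (U \<omega>) + d N (p N) * Z (p N) \<omega>\<bar> \<le> r N}"
    using below by (auto simp: less_Suc_eq split)
  then have "prob {\<omega>\<in>space M. \<forall>m<Suc N. \<bar>\<Sum>i\<in>I. d m i * Z i \<omega>\<bar> \<le> r m}
      \<le> prob {\<omega>\<in>space M. U \<omega> \<in> F} * (r N / d N (p N))"
    using indep_std_normal_small_ball[OF ind _ _ F a_meas, of "\<lambda>f. f (p N)" "d N (p N)" "r N" N]
      assms(3)[OF pN] Suc.prems(3,5)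
    by simp
  also have "\<dots> \<le> (\<Prod>m<N. r m / d m (p m)) * (r N / d N (p N))"
    unfolding below using Suc.prems by (intro mult_right_mono Suc.IH) (auto simp: inj_on_def less_imp_le)
  finally show ?case by simp
qed

section \<open>The process\<close>

text \<open>Blocks have J cells because a failure probability of 8^(-J) must beat about 2^J block
  positions. The factor 1/64 makes the probability per cell 8/64 = 1/8.\<close>

definition (in hurst_sequence) rough_at_level :: "(real \<Rightarrow> real) \<Rightarrow> nat \<Rightarrow> bool" where
  "rough_at_level f J \<longleftrightarrow> (\<forall>k0. k0 + J \<le> 2 ^ J \<longrightarrow> (\<exists>m<J.
     2 powr (- real J * H J (real (k0 + m) / 2 ^ J)) / 64
       \<le> \<bar>f ((real (k0 + m) + 1/2) / 2 ^ J) - f (real (k0 + m) / 2 ^ J)\<bar>))"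

locale haar_multifractional_process = prob_space M + hurst_sequence Hlow Hup C0 H
  for M :: "'a measure" and Hlow Hup C0 :: real and H :: "nat \<Rightarrow> real \<Rightarrow> real" +
  fixes \<epsilon> :: "nat \<Rightarrow> nat \<Rightarrow> 'a \<Rightarrow> real" and X :: "real \<Rightarrow> 'a \<Rightarrow> real"
  assumes family: "std_gaussian_family M \<epsilon>" and process: "is_GHBMP M H \<epsilon> X"
begin

abbreviation noise :: "'a \<Rightarrow> nat \<Rightarrow> nat \<Rightarrow> real" where
  "noise \<omega> \<equiv> \<lambda>j k. \<epsilon> j k \<omega>"

lemma noise_distributed: "k < 2 ^ j \<Longrightarrow> distributed M lborel (\<epsilon> j k) std_normal_density"
  using family by (auto simp: std_gaussian_family_def)

lemma noise_measurable: "k < 2 ^ j \<Longrightarrow> \<epsilon> j k \<in> borel_measurable M"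
  using noise_distributed by (auto simp: distributed_def)

lemma X_measurable: "0 \<le> t \<Longrightarrow> t \<le> 1 \<Longrightarrow> X t \<in> borel_measurable M"
  using process by (auto simp: is_GHBMP_def)

lemma partial_sum_eq: "ghbmp_partial_sum H \<epsilon> J t \<omega> = (\<Sum>j<J. level_sum (noise \<omega>) j t)"
  by (simp add: ghbmp_partial_sum_def level_sum_def)

lemma partial_sum_measurable [measurable]: "ghbmp_partial_sum H \<epsilon> J t \<in> borel_measurable M"
proof -
  have "(\<lambda>\<omega>. \<Sum>j<J. \<Sum>k<2 ^ j. ghbmp_coeff H j k t * \<epsilon> j k \<omega>) \<in> borel_measurable M"
    by (intro borel_measurable_sum borel_measurable_times borel_measurable_const noise_measurable) auto
  then show ?thesis by (simp add: ghbmp_partial_sum_def[abs_def])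
qed

lemma AE_linear_growth: "AE \<omega> in M. linear_growth (noise \<omega>)"
  using std_gaussian_family_linear_growth[OF family] by (simp add: linear_growth_def)

text \<open>The same partial sums converge to \<open>X t\<close> in mean square and to the series
  pathwise; Fatou applied to the squared distances identifies the limits.\<close>

lemma AE_X_eq_series:
  assumes "0 \<le> t" "t \<le> 1"
  shows "AE \<omega> in M. X t \<omega> = (\<Sum>j. level_sum (noise \<omega>) j t)"
proof -
  let ?S = "\<lambda>J \<omega>. ghbmp_partial_sum H \<epsilon> J t \<omega>"
  let ?d = "\<lambda>J \<omega>. ennreal ((X t \<omega> - ?S J \<omega>)\<^sup>2)"
  have [measurable]: "X t \<in> borel_measurable M" using X_measurable assms by simp
  have "(\<lambda>J. \<integral>\<^sup>+\<omega>. ?d J \<omega> \<partial>M) \<longlonglongrightarrow> 0"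
    using process assms by (auto simp: is_GHBMP_def)
  then have "liminf (\<lambda>J. \<integral>\<^sup>+\<omega>. ?d J \<omega> \<partial>M) = 0"
    by (intro lim_imp_Liminf) auto
  moreover have "(\<integral>\<^sup>+\<omega>. liminf (\<lambda>J. ?d J \<omega>) \<partial>M) \<le> liminf (\<lambda>J. \<integral>\<^sup>+\<omega>. ?d J \<omega> \<partial>M)"
    by (rule nn_integral_liminf) measurable
  ultimately have "(\<integral>\<^sup>+\<omega>. liminf (\<lambda>J. ?d J \<omega>) \<partial>M) = 0" by simp
  then have "AE \<omega> in M. liminf (\<lambda>J. ?d J \<omega>) = 0"
    by (subst (asm) nn_integral_0_iff_AE) measurable
  with AE_linear_growth show ?thesis
  proof eventually_elim
    fix \<omega> assume growth: "linear_growth (noise \<omega>)" and zero: "liminf (\<lambda>J. ?d J \<omega>) = 0"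
    let ?Y = "\<Sum>j. level_sum (noise \<omega>) j t"
    have "(\<lambda>J. ?S J \<omega>) \<longlonglongrightarrow> ?Y"
      unfolding partial_sum_eq using level_sum_summable[OF growth assms] by (rule summable_LIMSEQ)
    then have "(\<lambda>J. ?d J \<omega>) \<longlonglongrightarrow> ennreal ((X t \<omega> - ?Y)\<^sup>2)"
      by (intro tendsto_ennrealI tendsto_power tendsto_diff tendsto_const)
    then have "liminf (\<lambda>J. ?d J \<omega>) = ennreal ((X t \<omega> - ?Y)\<^sup>2)"
      by (intro lim_imp_Liminf) auto
    with zero have "(X t \<omega> - ?Y)\<^sup>2 \<le> 0" by (metis ennreal_eq_0_iff)
    then show "X t \<omega> = ?Y" by simp
  qed
qed

text \<open>Agreement at the rationals of (0,1) needs countably many null sets, and continuity of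
  both sides extends it to [0,1].\<close>

lemma AE_X_eq_series_all:
  "AE \<omega> in M. linear_growth (noise \<omega>) \<and> (\<forall>t\<in>{0..1}. X t \<omega> = (\<Sum>j. level_sum (noise \<omega>) j t))"
proof -
  have cl: "closure ({0<..<1} \<inter> \<rat>) = {0..1::real}"
    by (subst closure_open_Int_superset) (simp_all add: Rats_closure_real)
  have "AE \<omega> in M. \<forall>t\<in>{0<..<1} \<inter> \<rat>. X t \<omega> = (\<Sum>j. level_sum (noise \<omega>) j t)"
    by (rule AE_ball_countable') (auto intro!: AE_X_eq_series countable_Int2 countable_rat)
  with AE_linear_growth AE_space show ?thesis
  proof eventually_elim
    fix \<omega> assume \<omega>: "linear_growth (noise \<omega>)" "\<omega> \<in> space M"
      and eq: "\<forall>t\<in>{0<..<1} \<inter> \<rat>. X t \<omega> = (\<Sum>j. level_sum (noise \<omega>) j t)"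
    have "continuous_on {0..1} (\<lambda>t. X t \<omega>)" using process \<omega> by (auto simp: is_GHBMP_def)
    then have "continuous_on (closure ({0<..<1} \<inter> \<rat>)) (\<lambda>t. X t \<omega> - (\<Sum>j. level_sum (noise \<omega>) j t))"
      unfolding cl by (intro continuous_on_diff series_continuous \<omega>)
    from continuous_constant_on_closure[OF this, of 0] eq
    have "X t \<omega> - (\<Sum>j. level_sum (noise \<omega>) j t) = 0" if "t \<in> {0..1}" for t
      using that unfolding cl by auto
    with \<omega> show "linear_growth (noise \<omega>) \<and> (\<forall>t\<in>{0..1}. X t \<omega> = (\<Sum>j. level_sum (noise \<omega>) j t))"
      by auto
  qed
qed

section \<open>Simultaneously small increments over a block have small probability\<close>

text \<open>The pivots are the block variables at level J, present because J < n. All other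
  variables, also those of other levels, only move the centres of the small balls.\<close>

lemma partial_sum_increment_small_ball:
  fixes N k0 J n :: nat and r :: "nat \<Rightarrow> real"
  assumes block: "k0 + N \<le> 2 ^ J" and n: "J < n" and r: "\<And>m. m < N \<Longrightarrow> 0 \<le> r m"
  shows "prob {\<omega>\<in>space M. \<forall>m<N. \<bar>ghbmp_partial_sum H \<epsilon> n ((real (k0 + m) + 1/2) / 2 ^ J) \<omega>
       - ghbmp_partial_sum H \<epsilon> n (real (k0 + m) / 2 ^ J) \<omega>\<bar>
       \<le> r m * 2 powr (- real J * H J (real (k0 + m) / 2 ^ J))} \<le> (\<Prod>m<N. 8 * r m)"
proof -
  define I where "I = (SIGMA j:{..<n}. {..<2 ^ j :: nat})"
  define u where "u m = (real (k0 + m) + 1/2) / 2 ^ J" for m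
  define v where "v m = real (k0 + m) / 2 ^ J" for m
  define d where "d m = (\<lambda>(j, k). ghbmp_coeff H j k (u m) - ghbmp_coeff H j k (v m))" for m
  define p where "p m = (J, k0 + m)" for m
  define s where "s m = 2 powr (- real J * H J (real (k0 + m) / 2 ^ J))" for m
  have d: "ghbmp_partial_sum H \<epsilon> n (u m) \<omega> - ghbmp_partial_sum H \<epsilon> n (v m) \<omega>
      = (\<Sum>i\<in>I. d m i * (case i of (j, k) \<Rightarrow> \<epsilon> j k) \<omega>)" for m \<omega>
  proof -
    have "ghbmp_partial_sum H \<epsilon> n (u m) \<omega> - ghbmp_partial_sum H \<epsilon> n (v m) \<omega>
        = (\<Sum>j<n. \<Sum>k<2 ^ j. (ghbmp_coeff H j k (u m) - ghbmp_coeff H j k (v m)) * \<epsilon> j k \<omega>)"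
      by (simp add: ghbmp_partial_sum_def sum_subtractf left_diff_distrib)
    also have "\<dots> = (\<Sum>(j, k)\<in>I. (ghbmp_coeff H j k (u m) - ghbmp_coeff H j k (v m)) * \<epsilon> j k \<omega>)"
      unfolding I_def by (rule sum.Sigma) auto
    also have "\<dots> = (\<Sum>i\<in>I. d m i * (case i of (j, k) \<Rightarrow> \<epsilon> j k) \<omega>)"
      by (rule sum.cong) (auto simp: d_def)
    finally show ?thesis .
  qed
  have diag: "s m / 8 \<le> d m (p m)" if m: "m < N" for m
  proof -
    have k: "k0 + m < 2 ^ J" using m block by linarith
    define b where "b = H J (real (k0 + m) / 2 ^ J) + 1/2"
    have b: "1/2 \<le> b" "b \<le> 3/2" using H_dyadic[OF k] Hlow_pos Hup_less by (auto simp: b_def)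
    \<comment> \<open>The diagonal entry is the response at mid-cell minus its value 0 at the left
      end; b \<le> 3/2 gives at least (1/4)/(3/2) = 1/6.\<close>
    have "(1/2 :: real) * (1/2) \<le> (1/2) powr b"
      using powr_mono'[of b 2 "1/2 :: real"] b by (simp add: power2_eq_square)
    then have "1/8 \<le> (1/2) powr b / b"
      using b by (simp add: field_simps)
    moreover have "d m (p m) = s m * ((1/2) powr b / b)"
    proof -
      have uv: "2 ^ J * u m - real (k0 + m) = 1/2" "2 ^ J * v m - real (k0 + m) = 0"
        by (simp_all add: u_def v_def)
      show ?thesis
        unfolding d_def p_def prod.case coeff_eq[OF k] uv b_def[symmetric] s_def[symmetric]
        by (simp add: haar_response_def)
    qed
    ultimately show ?thesis using mult_left_mono[of "1/8" "(1/2) powr b / b" "s m"] by (simp add: s_def)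
  qed
  have s_pos: "0 < s m" for m by (simp add: s_def)
  \<comment> \<open>Causality: the response vanishes to the left of the wavelet.\<close>
  have off: "d m (p m') = 0" if m: "m < m'" "m' < N" for m m'
  proof -
    have k: "k0 + m' < 2 ^ J" using m block by linarith
    have "2 ^ J * u m - real (k0 + m') \<le> 0" "2 ^ J * v m - real (k0 + m') \<le> 0"
      using m by (simp_all add: u_def v_def)
    then show ?thesis by (simp add: d_def p_def coeff_eq[OF k] haar_response_nonpos)
  qed
  have I: "finite I" "p ` {..<N} \<subseteq> I" "I \<subseteq> {(j, k). k < 2 ^ j}"
    using block n by (auto simp: I_def p_def)
  have ind: "indep_vars (\<lambda>_. borel) (\<lambda>(j, k). \<epsilon> j k) I"
    using family I(3) unfolding std_gaussian_family_def by (blast intro: indep_vars_subset)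
  have "prob {\<omega>\<in>space M. \<forall>m<N. \<bar>\<Sum>i\<in>I. d m i * (case i of (j, k) \<Rightarrow> \<epsilon> j k) \<omega>\<bar> \<le> r m * s m}
      \<le> (\<Prod>m<N. r m * s m / d m (p m))"
  proof (rule triangular_small_ball[OF I(1) ind])
    show "distributed M lborel (case i of (j, k) \<Rightarrow> \<epsilon> j k) std_normal_density" if "i \<in> I" for i
      using that I(3) by (auto intro: noise_distributed)
    show "0 < d m (p m)" if "m < N" for m using diag[OF that] s_pos[of m] by linarith
  qed (use I off r s_pos in \<open>auto simp: inj_on_def p_def less_imp_le\<close>)
  also have "\<dots> \<le> (\<Prod>m<N. 8 * r m)"
  proof (rule prod_mono)
    fix m assume "m \<in> {..<N}"
    then have m: "m < N" by simp
    have "r m * s m / d m (p m) \<le> r m * s m / (s m / 8)"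
      using diag[OF m] s_pos[of m] r[OF m] by (intro divide_left_mono) auto
    then show "0 \<le> r m * s m / d m (p m) \<and> r m * s m / d m (p m) \<le> 8 * r m"
      using diag[OF m] s_pos[of m] r[OF m] by (auto simp: less_imp_le intro!: divide_nonneg_pos)
  qed
  finally show ?thesis unfolding d[symmetric] u_def v_def s_def .
qed

lemma small_increment_event:
  assumes block: "k0 + N \<le> 2 ^ J"
  shows "{\<omega>\<in>space M. \<forall>m<N. \<bar>X ((real (k0 + m) + 1/2) / 2 ^ J) \<omega> - X (real (k0 + m) / 2 ^ J) \<omega>\<bar>
       < 2 powr (- real J * H J (real (k0 + m) / 2 ^ J)) / 64} \<in> events"
proof -
  define u where "u m = (real (k0 + m) + 1/2) / 2 ^ J" for m
  define v where "v m = real (k0 + m) / 2 ^ J" for m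
  define s where "s m = 2 powr (- real J * H J (real (k0 + m) / 2 ^ J)) / 64" for m
  have meas: "(\<lambda>\<omega>. X (u m) \<omega> - X (v m) \<omega>) \<in> borel_measurable M" if "m < N" for m
  proof -
    have "k0 + m + 1 \<le> 2 ^ J" using that block by linarith
    then have "real (k0 + m + 1) \<le> real (2 ^ J)" by (simp only: of_nat_le_iff)
    then have "0 \<le> u m \<and> u m \<le> 1 \<and> 0 \<le> v m \<and> v m \<le> 1" by (simp add: u_def v_def)
    then show ?thesis by (intro borel_measurable_diff X_measurable) auto
  qed
  have "{\<omega>\<in>space M. \<forall>m\<in>{..<N}. \<bar>X (u m) \<omega> - X (v m) \<omega>\<bar> < s m} \<in> events"
  proof (rule sets.sets_Collect_finite_All)
    fix m assume "m \<in> {..<N}"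
    then show "{\<omega>\<in>space M. \<bar>X (u m) \<omega> - X (v m) \<omega>\<bar> < s m} \<in> events"
      by (intro borel_measurable_less borel_measurable_abs borel_measurable_const meas) simp
  qed simp
  then show ?thesis by (simp only: Ball_def lessThan_iff u_def v_def s_def)
qed

text \<open>Fatou passes from the partial sums to X. A strict inequality for the limit holds
  eventually along the sequence, which is why the event for X is strict and the one for partial sums
  is not.\<close>

lemma increment_small_ball:
  assumes block: "k0 + N \<le> 2 ^ J"
  shows "prob {\<omega>\<in>space M. \<forall>m<N. \<bar>X ((real (k0 + m) + 1/2) / 2 ^ J) \<omega> - X (real (k0 + m) / 2 ^ J) \<omega>\<bar>
       < 2 powr (- real J * H J (real (k0 + m) / 2 ^ J)) / 64} \<le> (1/8) ^ N"
proof -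
  define u where "u m = (real (k0 + m) + 1/2) / 2 ^ J" for m
  define v where "v m = real (k0 + m) / 2 ^ J" for m
  define s where "s m = 2 powr (- real J * H J (real (k0 + m) / 2 ^ J)) / 64" for m
  have uv: "0 \<le> u m \<and> u m \<le> 1 \<and> 0 \<le> v m \<and> v m \<le> 1" if "m < N" for m
  proof -
    have "k0 + m + 1 \<le> 2 ^ J" using that block by linarith
    then have "real (k0 + m + 1) \<le> real (2 ^ J)" by (simp only: of_nat_le_iff)
    then show ?thesis by (simp add: u_def v_def)
  qed
  define B where "B = {\<omega>\<in>space M. \<forall>m<N. \<bar>X (u m) \<omega> - X (v m) \<omega>\<bar> < s m}"
  define B' where "B' n = {\<omega>\<in>space M. \<forall>m<N. \<bar>ghbmp_partial_sum H \<epsilon> n (u m) \<omega> - ghbmp_partial_sum H \<epsilon> n (v m) \<omega>\<bar> \<le> s m}" for n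
  have B'_meas: "B' n \<in> events" for n unfolding B'_def by measurable
  have B_meas: "B \<in> events"
    unfolding B_def u_def v_def s_def by (rule small_increment_event[OF block])
  have "emeasure M B = (\<integral>\<^sup>+\<omega>. indicator B \<omega> \<partial>M)" using B_meas by simp
  also have "\<dots> \<le> (\<integral>\<^sup>+\<omega>. liminf (\<lambda>n. indicator (B' n) \<omega>) \<partial>M)"
  proof (rule nn_integral_mono_AE)
    show "AE \<omega> in M. indicator B \<omega> \<le> (liminf (\<lambda>n. indicator (B' n) \<omega>) :: ennreal)"
      using AE_X_eq_series_all AE_space
    proof eventually_elim
      fix \<omega> assume \<omega>: "linear_growth (noise \<omega>) \<and> (\<forall>t\<in>{0..1}. X t \<omega> = (\<Sum>j. level_sum (noise \<omega>) j t))" "\<omega> \<in> space M"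
      have lim: "(\<lambda>n. ghbmp_partial_sum H \<epsilon> n t \<omega>) \<longlonglongrightarrow> X t \<omega>" if "0 \<le> t" "t \<le> 1" for t
        unfolding partial_sum_eq using \<omega> that level_sum_summable[of "noise \<omega>" t]
        by (auto intro: summable_LIMSEQ)
      show "indicator B \<omega> \<le> (liminf (\<lambda>n. indicator (B' n) \<omega>) :: ennreal)"
      proof (cases "\<omega> \<in> B")
        case True
        have "\<forall>\<^sub>F n in sequentially. \<bar>ghbmp_partial_sum H \<epsilon> n (u m) \<omega> - ghbmp_partial_sum H \<epsilon> n (v m) \<omega>\<bar> < s m"
          if m: "m < N" for m
        proof (rule order_tendstoD)
          show "(\<lambda>n. \<bar>ghbmp_partial_sum H \<epsilon> n (u m) \<omega> - ghbmp_partial_sum H \<epsilon> n (v m) \<omega>\<bar>)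
              \<longlonglongrightarrow> \<bar>X (u m) \<omega> - X (v m) \<omega>\<bar>"
            using uv[OF m] by (intro tendsto_rabs tendsto_diff lim) auto
          show "\<bar>X (u m) \<omega> - X (v m) \<omega>\<bar> < s m" using True m by (simp add: B_def)
        qed
        then have "\<forall>\<^sub>F n in sequentially. \<forall>m\<in>{..<N}.
            \<bar>ghbmp_partial_sum H \<epsilon> n (u m) \<omega> - ghbmp_partial_sum H \<epsilon> n (v m) \<omega>\<bar> < s m"
          by (intro eventually_ball_finite) auto
        then have "\<forall>\<^sub>F n in sequentially. 1 \<le> (indicator (B' n) \<omega> :: ennreal)"
          by eventually_elim (use \<omega> in \<open>auto simp: B'_def less_imp_le\<close>)
        then have "1 \<le> liminf (\<lambda>n. indicator (B' n) \<omega> :: ennreal)" by (rule Liminf_bounded)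
        with True show ?thesis by simp
      qed simp
    qed
  qed
  also have "\<dots> \<le> liminf (\<lambda>n. \<integral>\<^sup>+\<omega>. indicator (B' n) \<omega> \<partial>M)"
    using B'_meas by (intro nn_integral_liminf) simp
  also have "\<dots> \<le> limsup (\<lambda>n. \<integral>\<^sup>+\<omega>. indicator (B' n) \<omega> \<partial>M)"
    by (intro Liminf_le_Limsup) simp
  also have "\<dots> \<le> ennreal ((1/8) ^ N)"
  proof (rule Limsup_bounded)
    show "\<forall>\<^sub>F n in sequentially. (\<integral>\<^sup>+\<omega>. indicator (B' n) \<omega> \<partial>M) \<le> ennreal ((1/8) ^ N)"
      using eventually_gt_at_top[of J]
    proof eventually_elim
      case (elim n)
      have "prob (B' n) \<le> (\<Prod>m<N. 8 * (1/64))"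
        using partial_sum_increment_small_ball[OF block elim, of "\<lambda>_. 1/64"]
        by (simp add: B'_def u_def v_def s_def)
      then show ?case using B'_meas[of n] by (simp add: emeasure_eq_measure ennreal_leI)
    qed
  qed
  finally have "prob B \<le> (1/8) ^ N" by (simp add: emeasure_eq_measure)
  then show ?thesis by (simp only: B_def u_def v_def s_def)
qed

text \<open>At most 2^J + 1 positions with probability 8^(-J) each total at most 2 * 4^(-J), so
  Borel-Cantelli applies.\<close>

lemma AE_eventually_rough: "AE \<omega> in M. eventually (rough_at_level (\<lambda>t. X t \<omega>)) sequentially"
proof -
  define B where "B J k0 = {\<omega>\<in>space M. \<forall>m<J. \<bar>X ((real (k0 + m) + 1/2) / 2 ^ J) \<omega> - X (real (k0 + m) / 2 ^ J) \<omega>\<bar>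
       < 2 powr (- real J * H J (real (k0 + m) / 2 ^ J)) / 64}" for J k0 :: nat
  have B: "B J k0 \<in> events" if "k0 + J \<le> 2 ^ J" for J k0
    unfolding B_def by (rule small_increment_event[OF that])
  define E where "E J = (\<Union>k0\<in>{k0. k0 + J \<le> 2 ^ J}. B J k0)" for J
  have fin: "finite {k0 :: nat. k0 + J \<le> 2 ^ J}" for J
    by (rule finite_subset[of _ "{..2 ^ J}"]) auto
  have E: "E J \<in> events" for J unfolding E_def using B fin by (intro sets.finite_UN) auto
  have "prob (E J) \<le> 2 * (1/4) ^ J" for J
  proof -
    have "prob (E J) \<le> (\<Sum>k0\<in>{k0. k0 + J \<le> 2 ^ J}. prob (B J k0))"
      unfolding E_def using B fin by (intro finite_measure_subadditive_finite) auto
    also have "\<dots> \<le> (\<Sum>k0\<in>{k0. k0 + J \<le> 2 ^ J}. (1/8) ^ J)"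
      unfolding B_def by (intro sum_mono increment_small_ball) simp
    also have "\<dots> \<le> (\<Sum>k0\<in>{..2 ^ J :: nat}. (1/8) ^ J)"
      by (intro sum_mono2) auto
    also have "\<dots> = (2 ^ J + 1) * (1/8) ^ J" by simp
    also have "\<dots> \<le> (2 * 2 ^ J) * (1/8) ^ J" by (intro mult_right_mono) auto
    also have "\<dots> = 2 * (1/4) ^ J" by (simp add: power_mult_distrib[symmetric])
    finally show ?thesis .
  qed
  then have "norm (prob (E J)) \<le> 2 * (1/4) ^ J" for J by simp
  moreover have "summable (\<lambda>J. 2 * (1/4 :: real) ^ J)" by (intro summable_mult summable_geometric) auto
  ultimately have "summable (\<lambda>J. prob (E J))"
    by (rule summable_comparison_test'[rotated])
  then have "AE \<omega> in M. eventually (\<lambda>J. \<omega> \<in> space M - E J) sequentially"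
    by (intro borel_cantelli_AE1 E) (simp add: emeasure_eq_measure)
  then show ?thesis
  proof eventually_elim
    fix \<omega> assume "eventually (\<lambda>J. \<omega> \<in> space M - E J) sequentially"
    then show "eventually (rough_at_level (\<lambda>t. X t \<omega>)) sequentially"
      by eventually_elim (auto simp: rough_at_level_def E_def B_def not_less)
  qed
qed

end

section \<open>From rough blocks to an upper bound for the exponent\<close>

context hurst_sequence begin

text \<open>A large increment in a block near t forces f to move by about
  \<open>2 powr (- real J * \<beta>')\<close>, while the Hoelder bound allows only a polynomial
  factor times \<open>2 powr (- real J * \<alpha>)\<close>. The gap between \<beta> and \<beta>'
  covers the variation of \<open>H J\<close> from t to the block.\<close>

lemma rough_imp_not_holder_at:
  assumes t: "0 < t" "t < 1" and freq: "\<exists>\<^sub>F j in sequentially. H j t < \<beta>" and "\<beta> < \<alpha>" "0 \<le> \<alpha>"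
    and rough: "eventually (rough_at_level f) sequentially" and "0 < \<delta>"
    and holder: "\<And>s. 0 \<le> s \<Longrightarrow> s \<le> 1 \<Longrightarrow> \<bar>s - t\<bar> < \<delta> \<Longrightarrow> \<bar>f s - f t\<bar> \<le> \<bar>s - t\<bar> powr \<alpha>"
  shows False
proof -
  obtain \<beta>' where \<beta>': "\<beta> < \<beta>'" "\<beta>' < \<alpha>" using dense[OF \<open>\<beta> < \<alpha>\<close>] by blast
  \<comment> \<open>Every point used from the block chosen below lies within J + 2 cells of
    t.\<close>
  define \<rho> where "\<rho> J = (real J + 2) / 2 powr real J" for J
  have "(\<lambda>J. \<bar>C0\<bar> * (1 + real J) * \<rho> J) \<longlonglongrightarrow> 0" "\<rho> \<longlonglongrightarrow> 0"
    unfolding \<rho>_def by real_asymp+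
  then have ev1: "\<forall>\<^sub>F J in sequentially. \<bar>C0\<bar> * (1 + real J) * \<rho> J < \<beta>' - \<beta>"
      and ev2: "\<forall>\<^sub>F J in sequentially. \<rho> J < \<delta>"
    using \<beta>' \<open>0 < \<delta>\<close> by (auto intro: order_tendstoD)
  have ev3: "\<forall>\<^sub>F J in sequentially. 2 * \<rho> J powr \<alpha> < 2 powr (- real J * \<beta>') / 64"
    unfolding \<rho>_def using \<beta>' \<open>0 \<le> \<alpha>\<close> by real_asymp
  \<comment> \<open>The smallness of \<open>H J t\<close> is known only for infinitely many J,
    everything else for all large J, so a common level exists.\<close>
  from freq eventually_conj[OF ev1 eventually_conj[OF ev2 eventually_conj[OF ev3 rough]]]
  obtain J where J: "H J t < \<beta>" "\<bar>C0\<bar> * (1 + real J) * \<rho> J < \<beta>' - \<beta>" "\<rho> J < \<delta>"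
    "2 * \<rho> J powr \<alpha> < 2 powr (- real J * \<beta>') / 64" "rough_at_level f J"
    using frequently_eventually_conj[of _ sequentially] frequently_ex by (smt (verit, best))
  define n where "n = nat \<lfloor>t * 2 ^ J\<rfloor>"
  \<comment> \<open>Cell n contains t. Near the right end of [0,1] the block starts earlier so as to
    fit, and n stays within J cells of its start.\<close>
  define k0 where "k0 = min n (2 ^ J - J)"
  have n: "real n \<le> t * 2 ^ J" "t * 2 ^ J < real n + 1"
    using t by (simp_all add: n_def)
  have J_le: "J \<le> 2 ^ J" by (simp add: less_imp_le)
  have "real n < 2 ^ J" using n t by (smt (verit) mult_le_cancel_right1 zero_less_power)
  then have "n < 2 ^ J" by (metis of_nat_less_iff of_nat_numeral of_nat_power)
  have k0: "k0 + J \<le> 2 ^ J" "k0 \<le> n" "n \<le> k0 + J"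
  proof -
    have "k0 \<le> 2 ^ J - J" unfolding k0_def by (rule min.cobounded2)
    then show "k0 + J \<le> 2 ^ J" using J_le by (simp only: le_diff_conv2)
    show "k0 \<le> n" "n \<le> k0 + J" using \<open>n < 2 ^ J\<close> by (auto simp: k0_def)
  qed
  obtain m where m: "m < J" and
    big: "2 powr (- real J * H J (real (k0 + m) / 2 ^ J)) / 64
       \<le> \<bar>f ((real (k0 + m) + 1/2) / 2 ^ J) - f (real (k0 + m) / 2 ^ J)\<bar>"
    using J(5) k0(1) by (auto simp: rough_at_level_def)
  define u where "u = (real (k0 + m) + 1/2) / 2 ^ J"
  define v where "v = real (k0 + m) / 2 ^ J"
  have "k0 + m + 1 \<le> 2 ^ J" using m k0 by linarith
  then have "real (k0 + m + 1) \<le> real (2 ^ J)" by (simp only: of_nat_le_iff)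
  then have uv: "0 \<le> u" "u \<le> 1" "0 \<le> v" "v \<le> 1" by (simp_all add: u_def v_def)
  have \<rho>_eq: "\<rho> J = (real J + 2) / 2 ^ J" by (simp add: \<rho>_def powr_realpow)
  have close: "\<bar>w / 2 ^ J - t\<bar> \<le> \<rho> J" if "real (k0 + m) \<le> w" "w \<le> real (k0 + m) + 1/2" for w
  proof -
    have "real k0 \<le> real n" "real n \<le> real k0 + real J" "real m < real J" using k0 m by linarith+
    then have "w - t * 2 ^ J \<le> real J + 2" "t * 2 ^ J - w \<le> real J + 2"
      using n that by simp_all
    then have "\<bar>w - t * 2 ^ J\<bar> \<le> real J + 2" by (simp add: abs_le_iff)
    moreover have "w / 2 ^ J - t = (w - t * 2 ^ J) / 2 ^ J" by (simp add: field_simps)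
    ultimately show ?thesis unfolding \<rho>_eq by (simp add: divide_right_mono)
  qed
  have close_uv: "\<bar>u - t\<bar> \<le> \<rho> J" "\<bar>v - t\<bar> \<le> \<rho> J"
    unfolding u_def v_def by (rule close; simp)+
  have "\<bar>f u - f t\<bar> \<le> \<rho> J powr \<alpha>" "\<bar>f v - f t\<bar> \<le> \<rho> J powr \<alpha>"
    using holder[of u] holder[of v] uv close_uv J(3) powr_mono2[OF \<open>0 \<le> \<alpha>\<close> abs_ge_zero close_uv(1)]
      powr_mono2[OF \<open>0 \<le> \<alpha>\<close> abs_ge_zero close_uv(2)] by simp_all
  then have "\<bar>f u - f v\<bar> \<le> 2 * \<rho> J powr \<alpha>" by linarith
  moreover have "H J v \<le> \<beta>'"
  proof -
    have "\<bar>H J v - H J t\<bar> \<le> C0 * (1 + real J) * \<bar>v - t\<bar>" using uv t by (intro H_lipschitz) auto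
    also have "\<dots> \<le> \<bar>C0\<bar> * (1 + real J) * \<rho> J" using close_uv by (intro mult_mono) auto
    finally show ?thesis using J(1,2) by linarith
  qed
  then have "2 powr (- real J * \<beta>') \<le> 2 powr (- real J * H J v)"
    by (intro powr_mono) (auto intro: mult_left_mono)
  ultimately show False using big J(4) unfolding u_def[symmetric] v_def[symmetric] by linarith
qed

end

section \<open>Evaluating the pointwise exponent and the Lipschitz norm\<close>

lemma at_zero_within_translate:
  fixes t :: real
  assumes "0 < t" "t < 1"
  shows "at 0 within {h. t + h \<in> {0..1}} = at 0"
proof (rule at_within_interior)
  have "{- t<..<1 - t} \<subseteq> {h. t + h \<in> {0..1}}" by auto
  then have "{- t<..<1 - t} \<subseteq> interior {h. t + h \<in> {0..1}}" by (rule interior_maximal) simp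
  then show "0 \<in> interior {h. t + h \<in> {0..1}}" using assms by auto
qed

text \<open>The definition asks for a zero limit of the quotient. A zero limit makes the quotient
  eventually less than 1, hence constant 1 in \<open>upper\<close>; conversely a bound with a larger
  exponent below L produces the zero limit.\<close>

lemma pointwise_holder_exponent_eqI:
  fixes L :: ereal
  assumes t: "0 < t" "t < 1" and "0 < L"
    and lower: "\<And>\<alpha>. 0 \<le> \<alpha> \<Longrightarrow> ereal \<alpha> < L \<Longrightarrow> \<exists>D. \<forall>s\<in>{0..1}. \<bar>f s - f t\<bar> \<le> D * \<bar>s - t\<bar> powr \<alpha>"
    and upper: "\<And>\<alpha> \<delta>. \<lbrakk>0 \<le> \<alpha>; L < ereal \<alpha>; 0 < \<delta>;
       \<And>s. 0 \<le> s \<Longrightarrow> s \<le> 1 \<Longrightarrow> \<bar>s - t\<bar> < \<delta> \<Longrightarrow> \<bar>f s - f t\<bar> \<le> \<bar>s - t\<bar> powr \<alpha>\<rbrakk> \<Longrightarrow> False"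
  shows "pointwise_holder_exponent f t = L"
proof -
  let ?q = "\<lambda>\<alpha> h. \<bar>f (t + h) - f t\<bar> / \<bar>h\<bar> powr \<alpha>"
  define A where "A = {\<alpha>. \<alpha> \<ge> 0 \<and> Limsup (at 0 within {h. t + h \<in> {0..1}}) (\<lambda>h. ereal (?q \<alpha> h)) = 0}"
  have exp: "pointwise_holder_exponent f t = Sup (ereal ` A)"
    by (simp add: pointwise_holder_exponent_def A_def)
  have inside: "\<forall>\<^sub>F h in at 0. t + h \<in> {0..1}"
    using t by (auto simp: eventually_at intro!: exI[of _ "min t (1 - t)"] simp: dist_real_def)
  have "ereal \<alpha> \<le> L" if "\<alpha> \<in> A" for \<alpha>
  proof (rule ccontr)
    assume "\<not> ereal \<alpha> \<le> L"
    then have "L < ereal \<alpha>" by simp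
    have \<alpha>: "0 \<le> \<alpha>" "Limsup (at 0) (\<lambda>h. ereal (?q \<alpha> h)) = 0"
      using that unfolding A_def at_zero_within_translate[OF t] by auto
    have "Limsup (at 0) (\<lambda>h. ereal (?q \<alpha> h)) < 1" using \<alpha> by simp
    then have "\<forall>\<^sub>F h in at 0. ereal (?q \<alpha> h) < 1" by (rule Limsup_lessD)
    then obtain \<delta> where \<delta>: "0 < \<delta>" "\<And>h. h \<noteq> 0 \<Longrightarrow> \<bar>h\<bar> < \<delta> \<Longrightarrow> ?q \<alpha> h < 1"
      by (auto simp: eventually_at dist_real_def)
    show False
    proof (rule upper[OF \<alpha>(1) \<open>L < ereal \<alpha>\<close> \<delta>(1)])
      fix s assume "\<bar>s - t\<bar> < \<delta>"
      then show "\<bar>f s - f t\<bar> \<le> \<bar>s - t\<bar> powr \<alpha>"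
        using \<delta>(2)[of "s - t"] by (cases "s = t") (auto simp: field_simps)
    qed
  qed
  then have "Sup (ereal ` A) \<le> L" by (auto intro: Sup_least)
  moreover have "L \<le> Sup (ereal ` A)"
  proof (rule ccontr)
    assume "\<not> L \<le> Sup (ereal ` A)"
    \<comment> \<open>The maximum with 0 makes the exponent \<alpha> chosen next positive, hence
      eligible for \<open>A\<close>; the bound is then taken at a larger \<alpha>'.\<close>
    then have "max 0 (Sup (ereal ` A)) < L" using \<open>0 < L\<close> by simp
    then obtain \<alpha> where \<alpha>: "max 0 (Sup (ereal ` A)) < ereal \<alpha>" "ereal \<alpha> < L"
      using ereal_dense2 by blast
    then obtain \<alpha>' where \<alpha>': "ereal \<alpha> < ereal \<alpha>'" "ereal \<alpha>' < L"
      using ereal_dense2 by blast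
    have pos: "0 < \<alpha>" "\<alpha> < \<alpha>'" using \<alpha> \<alpha>' by auto
    have "0 \<le> \<alpha>'" using pos by simp
    then obtain D where D: "\<forall>s\<in>{0..1}. \<bar>f s - f t\<bar> \<le> D * \<bar>s - t\<bar> powr \<alpha>'"
      using lower[OF _ \<alpha>'(2)] by blast
    have "((\<lambda>h. D * \<bar>h\<bar> powr (\<alpha>' - \<alpha>)) \<longlongrightarrow> D * \<bar>0\<bar> powr (\<alpha>' - \<alpha>)) (at 0)"
      using pos by (intro tendsto_mult tendsto_powr' tendsto_rabs tendsto_ident_at tendsto_const) auto
    then have lim: "((\<lambda>h. D * \<bar>h\<bar> powr (\<alpha>' - \<alpha>)) \<longlongrightarrow> 0) (at 0)" by simp
    have "\<forall>\<^sub>F h in at 0. norm (?q \<alpha> h) \<le> D * \<bar>h\<bar> powr (\<alpha>' - \<alpha>)"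
      using inside eventually_neq_at_within[of 0]
    proof eventually_elim
      case (elim h)
      have "?q \<alpha> h \<le> D * \<bar>h\<bar> powr \<alpha>' / \<bar>h\<bar> powr \<alpha>"
        using bspec[OF D elim(1)] by (intro divide_right_mono) auto
      also have "\<dots> = D * \<bar>h\<bar> powr (\<alpha>' - \<alpha>)" by (simp add: powr_diff)
      finally show ?case by simp
    qed
    from Lim_null_comparison[OF this lim] have "((\<lambda>h. ereal (?q \<alpha> h)) \<longlongrightarrow> ereal 0) (at 0)"
      by (intro tendsto_ereal)
    then have "Limsup (at 0) (\<lambda>h. ereal (?q \<alpha> h)) = 0"
      by (intro lim_imp_Limsup) (auto simp: zero_ereal_def)
    then have "\<alpha> \<in> A" using pos unfolding A_def at_zero_within_translate[OF t] by simp
    then have "ereal \<alpha> \<le> Sup (ereal ` A)" by (intro Sup_upper) auto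
    with \<alpha>(1) show False by (meson leD max_less_iff_conj)
  qed
  ultimately show ?thesis using exp by simp
qed

text \<open>The qualitative Lipschitz constant L ensures that both suprema are over bounded sets.
  The first is then nonnegative, so the norm dominates every difference quotient.\<close>

lemma lip_norm_bound:
  assumes lip: "L-lipschitz_on {0..1} f" and xy: "0 \<le> x" "x \<le> 1" "0 \<le> y" "y \<le> 1"
  shows "\<bar>f x - f y\<bar> \<le> lip_norm f * \<bar>x - y\<bar>"
proof -
  let ?P = "{(x', x''). 0 \<le> x' \<and> x' < x'' \<and> x'' \<le> (1::real)}"
  let ?q = "\<lambda>(x', x''). \<bar>f x'' - f x'\<bar> / (x'' - x')"
  have lipD: "\<bar>f a - f b\<bar> \<le> L * \<bar>a - b\<bar>" if "a \<in> {0..1}" "b \<in> {0..1}" for a b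
    using lipschitz_onD[OF lip that] by (simp add: dist_real_def)
  have "\<bar>f a\<bar> \<le> \<bar>f 0\<bar> + \<bar>L\<bar>" if "a \<in> {0..1}" for a
  proof -
    have "\<bar>f a - f 0\<bar> \<le> L * \<bar>a - 0\<bar>" using that by (intro lipD) auto
    also have "\<dots> \<le> \<bar>L\<bar> * 1" using that by (intro mult_mono) auto
    finally show ?thesis by linarith
  qed
  then have "bdd_above ((\<lambda>a. \<bar>f a\<bar>) ` {0..1})" by (rule bdd_aboveI2)
  then have sup1: "0 \<le> (SUP a\<in>{0..1}. \<bar>f a\<bar>)"
    by (intro order.trans[OF abs_ge_zero cSUP_upper[of 0]]) auto
  have "?q p \<le> L" if "p \<in> ?P" for p
    using that lipD[of "snd p" "fst p"] by (auto simp: divide_le_eq split: prod.splits)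
  then have bdd: "bdd_above (?q ` ?P)" by (rule bdd_aboveI2)
  have less: "\<bar>f b - f a\<bar> \<le> lip_norm f * (b - a)" if "0 \<le> a" "a < b" "b \<le> 1" for a b
  proof -
    have "?q (a, b) \<le> (SUP p\<in>?P. ?q p)" using that by (intro cSUP_upper bdd) auto
    also have "\<dots> \<le> lip_norm f" using sup1 by (simp add: lip_norm_def)
    finally show ?thesis using that by (simp add: divide_le_eq)
  qed
  show ?thesis
    using less[of x y] less[of y x] xy by (cases x y rule: linorder_cases) (auto simp: abs_minus_commute)
qed

section \<open>The exponent at all points on one almost sure event\<close>

context haar_multifractional_process begin

lemma AE_pointwise_holder_exponent:
  assumes H_low: "\<And>t. t \<in> {0<..<1} \<Longrightarrow> liminf (\<lambda>j. ereal (H j t)) < ereal (Hlow + 1/2)"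
  shows "AE \<omega> in M. \<forall>t\<in>{0<..<1}. pointwise_holder_exponent (\<lambda>u. X u \<omega>) t = liminf (\<lambda>j. ereal (H j t))"
  using AE_X_eq_series_all AE_eventually_rough
proof eventually_elim
  fix \<omega>
  assume \<omega>: "linear_growth (noise \<omega>) \<and> (\<forall>t\<in>{0..1}. X t \<omega> = (\<Sum>j. level_sum (noise \<omega>) j t))"
    and rough: "eventually (rough_at_level (\<lambda>t. X t \<omega>)) sequentially"
  show "\<forall>t\<in>{0<..<1}. pointwise_holder_exponent (\<lambda>u. X u \<omega>) t = liminf (\<lambda>j. ereal (H j t))"
  proof
    fix t :: real assume "t \<in> {0<..<1}"
    then have t: "0 < t" "t < 1" by auto
    show "pointwise_holder_exponent (\<lambda>u. X u \<omega>) t = liminf (\<lambda>j. ereal (H j t))"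
    proof (rule pointwise_holder_exponent_eqI[OF t])
      have "ereal Hlow \<le> liminf (\<lambda>j. ereal (H j t))"
        using H_range t by (intro Liminf_bounded) auto
      then show "0 < liminf (\<lambda>j. ereal (H j t))"
        using Hlow_pos by (metis ereal_less(2) less_le_trans)
    next
      fix \<alpha> assume \<alpha>: "0 \<le> \<alpha>" "ereal \<alpha> < liminf (\<lambda>j. ereal (H j t))"
      then obtain \<gamma> where \<gamma>: "ereal \<alpha> < ereal \<gamma>" "ereal \<gamma> < liminf (\<lambda>j. ereal (H j t))"
        using ereal_dense2 by blast
      then have "\<forall>\<^sub>F j in sequentially. ereal \<gamma> < ereal (H j t)" by (intro less_LiminfD)
      then have ev: "\<forall>\<^sub>F j in sequentially. \<gamma> \<le> H j t" by eventually_elim simp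
      \<comment> \<open>Here the hypothesis on the lower limit enters: it makes \<theta> = \<alpha>
        admissible in the increment bound for the response.\<close>
      have "ereal \<alpha> < ereal (Hlow + 1/2)" using \<alpha> H_low[OF \<open>t \<in> {0<..<1}\<close>] by (rule_tac less_trans)
      then have le: "\<alpha> \<le> Hlow + 1/2" by simp
      have "\<alpha> < \<gamma>" using \<gamma> by simp
      show "\<exists>D. \<forall>s\<in>{0..1}. \<bar>X s \<omega> - X t \<omega>\<bar> \<le> D * \<bar>s - t\<bar> powr \<alpha>"
      proof (rule series_holder_at[OF conjunct1[OF \<omega>] t ev \<alpha>(1) \<open>\<alpha> < \<gamma>\<close> le])
        fix D assume "\<And>s. \<lbrakk>0 \<le> s; s \<le> 1\<rbrakk> \<Longrightarrow>
          \<bar>(\<Sum>j. level_sum (noise \<omega>) j s) - (\<Sum>j. level_sum (noise \<omega>) j t)\<bar> \<le> D * \<bar>s - t\<bar> powr \<alpha>"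
        then show ?thesis using \<omega> t by (intro exI[of _ D]) auto
      qed
    next
      fix \<alpha> \<delta> :: real
      assume \<alpha>: "0 \<le> \<alpha>" "liminf (\<lambda>j. ereal (H j t)) < ereal \<alpha>" and \<delta>: "0 < \<delta>"
        and holder: "\<And>s. 0 \<le> s \<Longrightarrow> s \<le> 1 \<Longrightarrow> \<bar>s - t\<bar> < \<delta> \<Longrightarrow> \<bar>X s \<omega> - X t \<omega>\<bar> \<le> \<bar>s - t\<bar> powr \<alpha>"
      obtain \<beta> where \<beta>: "liminf (\<lambda>j. ereal (H j t)) < ereal \<beta>" "ereal \<beta> < ereal \<alpha>"
        using ereal_dense2[OF \<alpha>(2)] by blast
      \<comment> \<open>An eventual lower bound \<beta> would bound the lower limit from below, so
        values under \<beta> recur infinitely often.\<close>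
      have "\<not> (\<forall>\<^sub>F j in sequentially. ereal \<beta> \<le> ereal (H j t))"
        using \<beta>(1) Liminf_bounded[of "ereal \<beta>" _ sequentially] by (meson not_le)
      then have "\<exists>\<^sub>F j in sequentially. H j t < \<beta>" by (simp add: frequently_def not_less)
      then show False
        using \<beta>(2) \<alpha>(1) rough \<delta> holder by (intro rough_imp_not_holder_at[OF t, of \<beta> \<alpha>]) auto
    qed
  qed
qed

end

theorem theorem5p1:
  fixes M :: "'a measure"
    and Hlow Hup C0 :: real
    and H :: "nat \<Rightarrow> real \<Rightarrow> real"
    and \<epsilon> :: "nat \<Rightarrow> nat \<Rightarrow> 'a \<Rightarrow> real"
    and X :: "real \<Rightarrow> 'a \<Rightarrow> real"
  assumes "prob_space M"
    and "0 < Hlow" and "Hlow \<le> Hup" and "Hup < 1"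
    and "\<And>j. H j ` {0..1} \<subseteq> {Hlow..Hup}"
    and "\<And>j. \<exists>L. L-lipschitz_on {0..1} (H j)"
    and "C0 > 0" and "\<And>j. lip_norm (H j) \<le> C0 * (1 + real j)"
    and "\<And>t. t \<in> {0<..<1} \<Longrightarrow> liminf (\<lambda>j. ereal (H j t)) < ereal (Hlow + 1/2)"
    and "std_gaussian_family M \<epsilon>"
    and "is_GHBMP M H \<epsilon> X"
  shows "\<exists>\<Omega>\<^sub>0\<in>sets M. measure M \<Omega>\<^sub>0 = 1 \<and>
    (\<forall>\<omega>\<in>\<Omega>\<^sub>0. \<forall>t\<in>{0<..<1}.
       pointwise_holder_exponent (\<lambda>u. X u \<omega>) t = liminf (\<lambda>j. ereal (H j t)))"
proof -
  interpret prob_space M by fact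
  have range: "Hlow \<le> H j x \<and> H j x \<le> Hup" if "0 \<le> x" "x \<le> 1" for j x
    using assms(5)[of j] that by (auto simp: image_subset_iff)
  have lipschitz: "\<bar>H j x - H j y\<bar> \<le> C0 * (1 + real j) * \<bar>x - y\<bar>"
    if "0 \<le> x" "x \<le> 1" "0 \<le> y" "y \<le> 1" for j x y
  proof -
    obtain L where "L-lipschitz_on {0..1} (H j)" using assms(6) by blast
    from lip_norm_bound[OF this that]
    show ?thesis by (rule order.trans) (intro mult_right_mono assms(8) abs_ge_zero)
  qed
  interpret haar_multifractional_process M Hlow Hup C0 H \<epsilon> X
    by unfold_locales (use assms(2,4,10,11) range lipschitz in auto)
  have "AE \<omega> in M. \<forall>t\<in>{0<..<1}. pointwise_holder_exponent (\<lambda>u. X u \<omega>) t = liminf (\<lambda>j. ereal (H j t))"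
    using assms(9) by (rule AE_pointwise_holder_exponent)
  \<comment> \<open>The quantifier over t lies inside the almost sure statement, so the complement
    of one measurable null set is the universal event.\<close>
  then obtain N where N: "{\<omega>\<in>space M. \<not> (\<forall>t\<in>{0<..<1}. pointwise_holder_exponent (\<lambda>u. X u \<omega>) t
      = liminf (\<lambda>j. ereal (H j t)))} \<subseteq> N" "emeasure M N = 0" "N \<in> sets M"
    by (rule AE_E)
  have "measure M (space M - N) = 1"
    using prob_compl[OF N(3)] N(2) by (simp only: measure_def) simp
  with N show ?thesis by (intro bexI[of _ "space M - N"]) auto
qed

end
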